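(* There exists no quasiconformal tree $T$ such that every quasiconformal tree of valence at most $3$ quasisymmetrically embeds into $T$.
   Context: A metric tree is a compact, connected, locally connected metric space with at least two points in which any two points are joined by a unique arc. For $p$ in a metric tree $T$, the valence $\mathrm{val}(p,T)$ is the number of connected components of $T\setminus\{p\}$, and $\mathrm{val}(T)=\sup_{p\in T}\mathrm{val}(p,T)$. A metric space is doubling if there is $N\ge 1$ such that every ball can be covered by at most $N$ balls of half its radius; it is bounded turning if there is $C\ge1$ such that any two points $x,y$ can be joined by a continuum of diameter at most $C\,d(x,y)$. A quasiconformal tree is a metric tree that is doubling and bounded turning. A homeomorphism $f:X\to Y$ is quasisymmetric if there is a homeomorphism $\eta:[0,\infty)\to[0,\infty)$ with $d_Y(f(x),f(a))/d_Y(f(x),f(b))\le \eta\big(d_X(x,a)/d_X(x,b)\big)$ for all $x,a,b\in X$, $x\neq b$; a quasisymmetric embedding of $X$ into $Z$ is a quasisymmetric homeomorphism of $X$ onto a subset of $Z$. *)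

theory Defs
  imports "HOL-Analysis.Analysis" "HOL-Library.Extended_Nat"
begin

abbreviation mtop :: "'a set \<Rightarrow> ('a \<Rightarrow> 'a \<Rightarrow> real) \<Rightarrow> 'a topology" where
  "mtop M d \<equiv> Metric_space.mtopology M d"

definition is_arc_between :: "'a set \<Rightarrow> ('a \<Rightarrow> 'a \<Rightarrow> real) \<Rightarrow> 'a set \<Rightarrow> 'a \<Rightarrow> 'a \<Rightarrow> bool" where
  "is_arc_between M d A x y \<longleftrightarrow> A \<subseteq> M \<and>
     (\<exists>g. homeomorphic_map (top_of_set {0..1::real}) (subtopology (mtop M d) A) g
          \<and> g 0 = x \<and> g 1 = y)"

definition metric_tree :: "'a set \<Rightarrow> ('a \<Rightarrow> 'a \<Rightarrow> real) \<Rightarrow> bool" where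
  "metric_tree M d \<longleftrightarrow> Metric_space M d
     \<and> compact_space (mtop M d)
     \<and> connected_space (mtop M d)
     \<and> locally_connected_space (mtop M d)
     \<and> (\<exists>x\<in>M. \<exists>y\<in>M. x \<noteq> y)
     \<and> (\<forall>x\<in>M. \<forall>y\<in>M. x \<noteq> y \<longrightarrow> (\<exists>!A. is_arc_between M d A x y))"

definition valence_at :: "'a set \<Rightarrow> ('a \<Rightarrow> 'a \<Rightarrow> real) \<Rightarrow> 'a \<Rightarrow> enat" where
  "valence_at M d p =
     (let C = connected_components_of (subtopology (mtop M d) (M - {p}))
      in if finite C then enat (card C) else \<infinity>)"

definition valence :: "'a set \<Rightarrow> ('a \<Rightarrow> 'a \<Rightarrow> real) \<Rightarrow> enat" where
  "valence M d = (SUP p\<in>M. valence_at M d p)"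

definition doubling :: "'a set \<Rightarrow> ('a \<Rightarrow> 'a \<Rightarrow> real) \<Rightarrow> bool" where
  "doubling M d \<longleftrightarrow> (\<exists>N::nat. N \<ge> 1 \<and>
     (\<forall>x\<in>M. \<forall>r>0. \<exists>C. finite C \<and> C \<subseteq> M \<and> card C \<le> N \<and>
        Metric_space.mball M d x r \<subseteq> (\<Union>c\<in>C. Metric_space.mball M d c (r/2))))"

definition bounded_turning :: "'a set \<Rightarrow> ('a \<Rightarrow> 'a \<Rightarrow> real) \<Rightarrow> bool" where
  "bounded_turning M d \<longleftrightarrow> (\<exists>C::real. C \<ge> 1 \<and>
     (\<forall>x\<in>M. \<forall>y\<in>M. \<exists>K. K \<subseteq> M \<and> x \<in> K \<and> y \<in> K \<and>
        compactin (mtop M d) K \<and> connectedin (mtop M d) K \<and>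
        (\<forall>u\<in>K. \<forall>v\<in>K. d u v \<le> C * d x y)))"

definition quasiconformal_tree :: "'a set \<Rightarrow> ('a \<Rightarrow> 'a \<Rightarrow> real) \<Rightarrow> bool" where
  "quasiconformal_tree M d \<longleftrightarrow> metric_tree M d \<and> doubling M d \<and> bounded_turning M d"

definition qs_embedding ::
  "'a set \<Rightarrow> ('a \<Rightarrow> 'a \<Rightarrow> real) \<Rightarrow> 'b set \<Rightarrow> ('b \<Rightarrow> 'b \<Rightarrow> real) \<Rightarrow> ('a \<Rightarrow> 'b) \<Rightarrow> bool" where
  "qs_embedding X dX Y dY f \<longleftrightarrow> f ` X \<subseteq> Y
     \<and> homeomorphic_map (mtop X dX) (subtopology (mtop Y dY) (f ` X)) f
     \<and> (\<exists>eta. homeomorphic_map (top_of_set {0::real..}) (top_of_set {0::real..}) eta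
          \<and> (\<forall>x\<in>X. \<forall>a\<in>X. \<forall>b\<in>X. x \<noteq> b \<longrightarrow>
               dY (f x) (f a) / dY (f x) (f b) \<le> eta (dX x a / dX x b)))"

end

theory Submission
  imports Defs "HOL-Probability.Discrete_Topology"
begin

text \<open>
  Let \<open>T\<close> be a quasiconformal tree. Bounded turning yields short paths between nearby points, and since
  arcs in \<open>T\<close> are unique, the arc from \<open>x\<close> to \<open>y\<close> has diameter at most a constant times \<open>d(x, y)\<close>.
  Hence, if \<open>n\<close> points at distance \<open>R\<close> from a point \<open>p\<close> are such that the arc between any two of them
  comes within \<open>R/4\<close> of \<open>p\<close>, then they are separated by a constant times \<open>R\<close>, and doubling bounds \<open>n\<close> in
  terms of \<open>T\<close> alone.

  For every \<open>n\<close> there is a comb of valence at most 3, an interval with countably many teeth attached at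
  distinct points, that contains \<open>n\<close> teeth of length at least \<open>r\<close> based within \<open>\<epsilon> r\<close> of a point \<open>p\<close>, for
  arbitrarily small \<open>\<epsilon>\<close>. A quasisymmetric map sends the base of these teeth to a set that is small compared
  with the images of the teeth once \<open>\<epsilon>\<close> is small enough, so cutting these images at a common distance
  \<open>R\<close> from the image of \<open>p\<close> produces \<open>n\<close> points as above.
\<close>

section \<open>Arcs in bounded turning trees\<close>

lemma is_arc_between_image:
  assumes "Metric_space M d" "continuous_map (top_of_set {0..1::real}) (mtop M d) g" "inj_on g {0..1}"
  shows "is_arc_between M d (g ` {0..1}) (g 0) (g 1)"
proof -
  interpret Metric_space M d by fact
  have sub: "g ` {0..1} \<subseteq> M"
    using assms(2) by (force simp: continuous_map_def)
  have "homeomorphic_map (top_of_set {0..1}) (subtopology mtopology (g ` {0..1})) g"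
  proof (rule continuous_imp_homeomorphic_map)
    show "continuous_map (top_of_set {0..1}) (subtopology mtopology (g ` {0..1})) g"
      using assms(2) by (auto simp: continuous_map_in_subtopology)
    show "compact_space (top_of_set {0..1::real})"
      by (simp add: compact_space_subtopology)
    show "Hausdorff_space (subtopology mtopology (g ` {0..1}))"
      by (simp add: Hausdorff_space_mtopology Hausdorff_space_subtopology)
  qed (use assms(3) sub in auto)
  then show ?thesis
    using sub unfolding is_arc_between_def by blast
qed

lemma is_arc_between_connectedin:
  assumes "is_arc_between M d A x y" "Metric_space M d"
  shows "connectedin (mtop M d) A" "x \<in> A" "y \<in> A"
proof -
  interpret Metric_space M d by fact
  from assms(1) obtain g where A: "A \<subseteq> M" and
    g: "homeomorphic_map (top_of_set {0..1::real}) (subtopology mtopology A) g" "g 0 = x" "g 1 = y"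
    unfolding is_arc_between_def by blast
  have im: "g ` {0..1} = A"
    using homeomorphic_imp_surjective_map[OF g(1)] A by (simp add: Int_absorb1)
  have "connectedin (subtopology mtopology A) (g ` {0..1})"
    by (rule connectedin_continuous_map_image[OF homeomorphic_imp_continuous_map[OF g(1)]])
      (simp add: connectedin_subtopology)
  then show "connectedin (mtop M d) A"
    using im by (simp add: connectedin_subtopology)
  show "x \<in> A" "y \<in> A" using im g by force+
qed

text \<open>Pulled back to the unit interval, a connected set that contains both endpoints is
  everything. This is what turns inclusion of a segment in an arc into equality in
  \<open>unique_arc\<close>.\<close>

lemma is_arc_between_irreducible:
  assumes "is_arc_between M d A x y" "Metric_space M d"
    and "connectedin (mtop M d) K" "K \<subseteq> A" "x \<in> K" "y \<in> K"
  shows "K = A"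
proof -
  interpret Metric_space M d by fact
  from assms(1) obtain g where A: "A \<subseteq> M" and
    g: "homeomorphic_map (top_of_set {0..1::real}) (subtopology mtopology A) g" "g 0 = x" "g 1 = y"
    unfolding is_arc_between_def by blast
  obtain h where "homeomorphic_maps (top_of_set {0..1}) (subtopology mtopology A) g h"
    using g(1) homeomorphic_map_maps by blast
  then have h: "continuous_map (subtopology mtopology A) (top_of_set {0..1}) h"
    and hg: "\<And>t. t \<in> {0..1} \<Longrightarrow> h (g t) = t" and gh: "\<And>a. a \<in> A \<Longrightarrow> g (h a) = a"
    using A by (auto simp: homeomorphic_maps_def)
  have "connectedin (top_of_set {0..1}) (h ` K)"
    by (rule connectedin_continuous_map_image[OF h]) (simp add: assms connectedin_subtopology)
  then have con: "connected (h ` K)" and sub: "h ` K \<subseteq> {0..1}"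
    by (auto simp: connectedin_subtopology)
  have "h x = 0" "h y = 1"
    using hg[of 0] hg[of 1] unfolding g(2,3) by auto
  then have "0 \<in> h ` K" "1 \<in> h ` K"
    using imageI[OF assms(5), of h] imageI[OF assms(6), of h] by metis+
  then have "{0..1} \<subseteq> h ` K"
    using connected_contains_Icc[OF con] by blast
  moreover have "h a \<in> {0..1}" if "a \<in> A" for a
    using h that A by (auto simp: continuous_map_def)
  ultimately show ?thesis
    using assms(4) gh by (smt (verit, ccfv_threshold) imageE subsetD subsetI subset_antisym)
qed

section \<open>Fine chains, and paths from bounded turning\<close>

context Metric_space
begin

text \<open>If \<open>y\<close> could not be reached from \<open>x\<close> by short steps inside
  \<open>K\<close>, then the open neighbourhoods of the reachable and of the unreachable points,
  \<open>E id\<close> and \<open>E Not\<close>, would disconnect \<open>K\<close>.\<close>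

lemma connectedin_imp_chain:
  assumes "connectedin mtopology K" "x \<in> K" "y \<in> K" "\<epsilon> > 0"
  shows "\<exists>q z. z 0 = x \<and> z q = y \<and> (\<forall>i\<le>q. z i \<in> K) \<and> (\<forall>i<q. d (z i) (z (Suc i)) < \<epsilon>)"
proof -
  define R where "R = (\<lambda>a b. a \<in> K \<and> b \<in> K \<and> d a b < \<epsilon>)"
  have KM: "K \<subseteq> M" using assms(1) by (simp add: connectedin_def)
  define E where "E = (\<lambda>Q. \<Union>b \<in> {b \<in> K. Q (R\<^sup>*\<^sup>* x b)}. mball b \<epsilon>)"
  have "R\<^sup>*\<^sup>* x y"
  proof (rule ccontr)
    assume y: "\<not> R\<^sup>*\<^sup>* x y"
    show False
    proof (rule connectedinD[OF assms(1)])
      show "openin mtopology (E id)" "openin mtopology (E Not)"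
        unfolding E_def by blast+
      show "K \<subseteq> E id \<union> E Not"
        using KM assms by (fastforce simp: E_def)
      show "E id \<inter> E Not \<inter> K = {}"
      proof -
        have False if "b \<in> K" "R\<^sup>*\<^sup>* x b" "b' \<in> K" "\<not> R\<^sup>*\<^sup>* x b'" "d b c < \<epsilon>" "d b' c < \<epsilon>" "c \<in> K" for b b' c
        proof -
          have "R b c" "R c b'" using that by (auto simp: R_def commute)
          then show False using rtranclp.rtrancl_into_rtrancl[of R] that(2,4) by blast
        qed
        then show ?thesis by (auto simp: E_def)
      qed
      show "E id \<inter> K \<noteq> {}" using assms KM by (force simp: E_def)
      show "E Not \<inter> K \<noteq> {}" using assms KM y by (force simp: E_def)
    qed
  qed
  then obtain q where "(R ^^ q) x y" by (auto simp: rtranclp_power)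
  then obtain z where z: "z 0 = x" "z q = y" "\<forall>i<q. R (z i) (z (Suc i))"
    by (auto simp: relpowp_fun_conv)
  then have "\<forall>i\<le>q. z i \<in> K"
    using assms by (metis R_def le_neq_implies_less)
  with z show ?thesis unfolding R_def by blast
qed

text \<open>The constant is a parameter because the bounds on the limit path depend on it.\<close>

definition turning :: "real \<Rightarrow> bool" where
  "turning C \<longleftrightarrow> (\<forall>x\<in>M. \<forall>y\<in>M. \<exists>K. K \<subseteq> M \<and> x \<in> K \<and> y \<in> K \<and> connectedin mtopology K \<and>
     (\<forall>u\<in>K. \<forall>v\<in>K. d u v \<le> C * d x y))"

text \<open>All links of the chain are subdivided into the same number of links, so that the refinement
  is indexed compatibly with division by \<open>q\<close>.\<close>
lemma turning_refine:
  assumes C: "turning C" "0 \<le> C" and z: "\<And>i. i \<le> l \<Longrightarrow> z i \<in> M"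
    and zd: "\<And>i. i < l \<Longrightarrow> d (z i) (z (Suc i)) < \<epsilon>" and pos: "\<epsilon> > 0" "\<epsilon>' > 0"
  shows "\<exists>q z'. q \<ge> 1 \<and> z' 0 = z 0 \<and> z' (l * q) = z l \<and> (\<forall>i \<le> l * q. z' i \<in> M) \<and>
           (\<forall>i < l * q. d (z' i) (z' (Suc i)) < \<epsilon>') \<and>
           (\<forall>i \<le> l * q. d (z' i) (z (i div q)) \<le> C * \<epsilon>)"
proof -
  have "\<exists>p w. w 0 = z i \<and> w p = z (Suc i) \<and>
          (\<forall>j\<le>p. w j \<in> M \<and> d (w j) (z i) \<le> C * \<epsilon>) \<and> (\<forall>j<p. d (w j) (w (Suc j)) < \<epsilon>')" if i: "i < l" for i
  proof -
    obtain K where K: "K \<subseteq> M" "z i \<in> K" "z (Suc i) \<in> K" "connectedin mtopology K"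
        "\<And>u v. u \<in> K \<Longrightarrow> v \<in> K \<Longrightarrow> d u v \<le> C * d (z i) (z (Suc i))"
      using C(1) z[of i] z[of "Suc i"] i unfolding turning_def by (metis Suc_leI less_imp_le)
    obtain p w where w: "w 0 = z i" "w p = z (Suc i)" "\<forall>j\<le>p. w j \<in> K" "\<forall>j<p. d (w j) (w (Suc j)) < \<epsilon>'"
      using connectedin_imp_chain[OF K(4,2,3) pos(2)] by blast
    have "d u (z i) \<le> C * \<epsilon>" if "u \<in> K" for u
      using K(5)[OF that K(2)] zd[OF i] C(2) by (meson less_eq_real_def mult_left_mono order_trans)
    then show ?thesis using w K(1) by blast
  qed
  then obtain p w where w: "\<And>i. i < l \<Longrightarrow> w i 0 = z i \<and> w i (p i) = z (Suc i) \<and>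
          (\<forall>j\<le>p i. w i j \<in> M \<and> d (w i j) (z i) \<le> C * \<epsilon>) \<and> (\<forall>j<p i. d (w i j) (w i (Suc j)) < \<epsilon>')"
    by metis
  \<comment> \<open>\<open>q\<close> strictly exceeds every \<open>p i\<close>, so each chain,
    padded by repeating its last point, has already reached \<open>z (Suc i)\<close> at the end of
    its block. The links between blocks are then trivial.\<close>
  define q where "q = Suc (\<Sum>i<l. p i)"
  have pq: "p i < q" if "i < l" for i
    unfolding q_def using that by (simp add: le_imp_less_Suc member_le_sum)
  have q0: "q > 0" by (simp add: q_def)
  define z' where "z' i = (if i < l * q then w (i div q) (min (i mod q) (p (i div q))) else z l)" for i
  have div: "i div q < l" if "i < l * q" for i
    using that by (simp add: less_mult_imp_div_less)
  have start: "z' (a * q) = z a" if "a \<le> l" for a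
    using that w q0 by (auto simp: z'_def)
  show ?thesis
  proof (intro exI[of _ q] exI[of _ z'] conjI allI impI)
    show "1 \<le> q" by (simp add: q_def)
    show "z' 0 = z 0" using start[of 0] by simp
    show "z' (l * q) = z l" by (simp add: start)
    show "z' i \<in> M" if "i \<le> l * q" for i
      using w[OF div] z[of l] by (auto simp: z'_def)
    show "d (z' i) (z (i div q)) \<le> C * \<epsilon>" if "i \<le> l * q" for i
    proof (cases "i < l * q")
      case True
      then show ?thesis using w[OF div] by (auto simp: z'_def)
    next
      case False
      then have "i = l * q" using that by simp
      then show ?thesis using q0 z[of l] C(2) pos by (simp add: start)
    qed
    show "d (z' i) (z' (Suc i)) < \<epsilon>'" if i: "i < l * q" for i
    proof -
      define a where "a = i div q"
      have a: "a < l" using div i a_def by blast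
      have z'i: "z' i = w a (min (i mod q) (p a))" using i by (simp add: z'_def a_def)
      show ?thesis
      proof (cases "Suc (i mod q) = q")
        case True
        then have e: "Suc i = Suc a * q"
          unfolding a_def by (metis div_mult_mod_eq add_Suc_right mult_Suc add.commute)
        have "z' (Suc i) = z (Suc a)"
          using start[of "Suc a"] a e by simp
        moreover have "z' i = z (Suc a)"
          using z'i True pq[OF a] w[OF a] by (simp add: min_absorb2)
        ultimately show ?thesis using pos a z[of "Suc a"] by simp
      next
        case False
        have m: "Suc i mod q = Suc (i mod q)" "Suc i div q = a"
          using False by (auto simp: mod_Suc div_Suc a_def)
        have "Suc i < l * q"
          using i False by (metis Suc_lessI mod_mult_self2_is_0 m(1) nat.distinct(1))
        then have e: "z' (Suc i) = w a (min (Suc (i mod q)) (p a))"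
          using m by (simp add: z'_def)
        show ?thesis
        proof (cases "i mod q < p a")
          case True
          then show ?thesis using w[OF a] by (simp add: e z'i)
        next
          case False
          then have "z' i = z (Suc a)" "z' (Suc i) = z (Suc a)"
            using w[OF a] by (auto simp: e z'i min_absorb2)
          then show ?thesis using z[of "Suc a"] a pos by simp
        qed
      qed
    qed
  qed
qed

lemma mcomplete_geometric_limit:
  assumes "mcomplete" "\<And>n. \<sigma> n \<in> M" "\<And>n. d (\<sigma> (Suc n)) (\<sigma> n) \<le> B / 2 ^ n"
  shows "\<exists>l\<in>M. \<forall>n. d (\<sigma> n) l \<le> 2 * B / 2 ^ n"
proof -
  have B: "B \<ge> 0" using assms(3)[of 0] nonneg order_trans by (metis div_by_1 power_0)
  have tail: "d (\<sigma> n) (\<sigma> (n + m)) \<le> 2 * B / 2 ^ n" for n m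
  proof -
    \<comment> \<open>Subtracting the remaining tail of the geometric series is what makes the
      induction close.\<close>
    have "d (\<sigma> n) (\<sigma> (n + m)) \<le> 2 * B / 2 ^ n - 2 * B / 2 ^ (n + m)"
    proof (induction m)
      case (Suc m)
      have "d (\<sigma> n) (\<sigma> (n + Suc m)) \<le> d (\<sigma> n) (\<sigma> (n + m)) + B / 2 ^ (n + m)"
        using triangle'[of "\<sigma> n" "\<sigma> (n + m)" "\<sigma> (Suc (n + m))"] assms(2) assms(3)[of "n + m"] by simp
      moreover have "2 * B / 2 ^ (n + m) - B / 2 ^ (n + m) = 2 * B / 2 ^ (n + Suc m)" by (simp add: field_simps)
      ultimately show ?case using Suc by linarith
    qed (use assms(2) in simp)
    moreover have "0 \<le> 2 * B / 2 ^ (n + m)" using B by simp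
    ultimately show ?thesis by linarith
  qed
  have lim0: "(\<lambda>n. 2 * B / 2 ^ n) \<longlonglongrightarrow> 0"
    using tendsto_mult_right_zero[OF LIMSEQ_inverse_realpow_zero[of 2], of "2 * B"] by (simp add: field_simps)
  have "MCauchy \<sigma>"
    unfolding MCauchy_def
  proof (intro conjI allI impI)
    show "range \<sigma> \<subseteq> M" using assms(2) by blast
    fix \<epsilon> :: real assume "\<epsilon> > 0"
    then obtain N where N: "2 * B / 2 ^ N < \<epsilon> / 2"
      using order_tendstoD(2)[OF lim0, of "\<epsilon>/2"] by (auto simp: eventually_sequentially)
    have "d (\<sigma> n) (\<sigma> n') < \<epsilon>" if "N \<le> n" "N \<le> n'" for n n'
      using triangle''[of "\<sigma> n" "\<sigma> n'" "\<sigma> N"] tail[of N "n - N"] tail[of N "n' - N"] that N assms(2)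
        commute[of "\<sigma> N"] triangle[of "\<sigma> n" "\<sigma> N" "\<sigma> n'"] by simp
    then show "\<exists>N. \<forall>n n'. N \<le> n \<longrightarrow> N \<le> n' \<longrightarrow> d (\<sigma> n) (\<sigma> n') < \<epsilon>" by blast
  qed
  then obtain l where l: "limitin mtopology \<sigma> l sequentially"
    using assms(1) mcomplete_def by blast
  then have lM: "l \<in> M" by (simp add: limitin_mspace)
  have "d (\<sigma> n) l \<le> 2 * B / 2 ^ n" for n
  proof (rule field_le_epsilon)
    fix e :: real assume "e > 0"
    then obtain N where N: "\<forall>m\<ge>N. d (\<sigma> m) l < e"
      using l unfolding limit_metric_sequentially by meson
    show "d (\<sigma> n) l \<le> 2 * B / 2 ^ n + e"
      using triangle[of "\<sigma> n" "\<sigma> (n + N)" l] tail[of n N] N[rule_format, of "n + N"] lM assms(2) by simp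
  qed
  with lM show ?thesis by blast
qed

text \<open>Bounded turning replaces local connectedness as the source of paths: a continuum joining two points
  contains fine chains, whose links are again joined by small continua, and the chains obtained by
  iterating this converge uniformly.\<close>
lemma turning_imp_path:
  assumes "mcomplete" and C: "turning C" "0 \<le> C" and xy: "x \<in> M" "y \<in> M" "x \<noteq> y"
  shows "\<exists>\<gamma>. continuous_map (top_of_set {0..1::real}) mtopology \<gamma> \<and> \<gamma> 0 = x \<and> \<gamma> 1 = y \<and>
           (\<forall>t\<in>{0..1}. d x (\<gamma> t) \<le> (4 * C + 1) * d x y)"
proof -
  \<comment> \<open>The factor 2 gives the initial chain, a single link from \<open>x\<close> to
    \<open>y\<close>, a strict bound.\<close>
  define D where "D = 2 * d x y"
  have D: "D > 0" using xy by (simp add: D_def)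
  define Inv where "Inv = (\<lambda>k s. case s of (l::nat, z) \<Rightarrow> l \<ge> 1 \<and> z 0 = x \<and> z l = y \<and> (\<forall>i\<le>l. z i \<in> M) \<and>
      (\<forall>i<l. d (z i) (z (Suc i)) < D / 2 ^ k) \<and> (k = (0::nat) \<longrightarrow> l = 1))"
  define Rel where "Rel = (\<lambda>k s s'. case s of (l::nat, z) \<Rightarrow> case s' of (l', z') \<Rightarrow>
      \<exists>q\<ge>1. l' = l * q \<and> (\<forall>i\<le>l'. d (z' i) (z (i div q)) \<le> C * (D / 2 ^ (k::nat))))"
  have "\<exists>f. \<forall>k. Inv k (f k) \<and> Rel k (f k) (f (Suc k))"
  proof (rule dependent_nat_choice)
    have "Inv 0 (1, \<lambda>i. if i = 0 then x else y)"
      using xy D unfolding Inv_def D_def by (auto simp: le_Suc_eq)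
    then show "\<exists>s. Inv 0 s" by blast
  next
    fix s k assume I: "Inv k s"
    obtain l z where s: "s = (l, z)" by fastforce
    obtain q z' where "q \<ge> 1" "z' 0 = z 0" "z' (l * q) = z l" "\<forall>i \<le> l * q. z' i \<in> M"
        "\<forall>i < l * q. d (z' i) (z' (Suc i)) < D / 2 ^ Suc k"
        "\<forall>i \<le> l * q. d (z' i) (z (i div q)) \<le> C * (D / 2 ^ k)"
      using turning_refine[OF C, of l z "D / 2 ^ k" "D / 2 ^ Suc k"] I D unfolding s Inv_def by auto
    then have "Inv (Suc k) (l * q, z') \<and> Rel k s (l * q, z')"
      using I unfolding Inv_def Rel_def s by (auto simp: Suc_le_eq)
    then show "\<exists>s'. Inv (Suc k) s' \<and> Rel k s s'" by blast
  qed
  then obtain f where f: "\<And>k. Inv k (f k)" "\<And>k. Rel k (f k) (f (Suc k))" by blast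
  define l where "l k = fst (f k)" for k
  define z where "z k = snd (f k)" for k
  have lz: "l k \<ge> 1" "z k 0 = x" "z k (l k) = y" "l 0 = 1"
    "\<And>i. i \<le> l k \<Longrightarrow> z k i \<in> M" "\<And>i. i < l k \<Longrightarrow> d (z k i) (z k (Suc i)) < D / 2 ^ k" for k
    using f(1)[of k] f(1)[of 0] by (auto simp: Inv_def l_def z_def split: prod.splits)
  have ref: "\<exists>q\<ge>1. l (Suc k) = l k * q \<and> (\<forall>i\<le>l (Suc k). d (z (Suc k) i) (z k (i div q)) \<le> C * (D / 2 ^ k))" for k
    using f(2)[of k] by (auto simp: Rel_def l_def z_def split: prod.splits)
  define j where "j k t = nat \<lfloor>real (l k) * t\<rfloor>" for k t
  have j: "j k t \<le> l k" if "t \<in> {0..1}" for k t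
  proof -
    have "real (l k) * t \<le> real (l k)" using that by (simp add: mult_left_le)
    then show ?thesis unfolding j_def by linarith
  qed
  define g where "g k t = z k (j k t)" for k t
  have gM: "g k t \<in> M" if "t \<in> {0..1}" for k t using lz(5)[OF j[OF that]] by (simp add: g_def)
  have step: "d (g (Suc k) t) (g k t) \<le> C * D / 2 ^ k" if t: "t \<in> {0..1}" for k t
  proof -
    obtain q where q: "q \<ge> 1" "l (Suc k) = l k * q"
       "\<And>i. i\<le>l (Suc k) \<Longrightarrow> d (z (Suc k) i) (z k (i div q)) \<le> C * (D / 2 ^ k)"
      using ref by blast
    \<comment> \<open>Since the refinement factor \<open>q\<close> is uniform, the index at level
      \<open>k\<close> is the quotient by \<open>q\<close> of the index at level
      \<open>Suc k\<close>. Thus consecutive step functions \<open>g k\<close> are compared by the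
      last estimate of \<open>turning_refine\<close>.\<close>
    have "real (l k) * t = real (l (Suc k)) * t / real_of_int (int q)"
      using q by (simp add: field_simps)
    then have "\<lfloor>real (l k) * t\<rfloor> = \<lfloor>real (l (Suc k)) * t\<rfloor> div int q"
      using floor_divide_real_eq_div[of "int q" "real (l (Suc k)) * t"] by simp
    then have "j (Suc k) t div q = j k t"
      using t unfolding j_def by (simp add: nat_div_distrib)
    then show ?thesis using q(3)[OF j[OF t]] by (simp add: g_def)
  qed
  have "\<exists>a\<in>M. \<forall>k. d (g k t) a \<le> 2 * (C * D) / 2 ^ k" if t: "t \<in> {0..1}" for t
    using mcomplete_geometric_limit[OF assms(1), of "\<lambda>k. g k t" "C * D"] gM[OF t] step[OF t] by auto
  then obtain \<gamma> where \<gamma>: "\<And>t. t \<in> {0..1} \<Longrightarrow> \<gamma> t \<in> M" and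
      lim: "\<And>t k. t \<in> {0..1} \<Longrightarrow> d (g k t) (\<gamma> t) \<le> 2 * (C * D) / 2 ^ k"
    by metis
  have osc: "d (g k s) (g k t) \<le> D / 2 ^ k" if st: "s \<in> {0..1}" "t \<in> {0..1}" "s \<le> t" "t - s < 1 / l k" for s t k
  proof -
    have "real (l k) * t \<le> real (l k) * s + 1" 
      using st(4) lz(1)[of k] by (simp add: field_simps)
    moreover have "real (l k) * s \<le> real (l k) * t" using st(3) by (simp add: mult_left_mono)
    \<comment> \<open>The two indices are equal or consecutive, so the step functions differ by at
      most one link.\<close>
    ultimately have "j k t = j k s \<or> j k t = Suc (j k s)"
      using st(1) unfolding j_def by (smt (verit, best) Suc_nat_eq_nat_zadd1 atLeastAtMost_iff floor_mono floor_of_nat le_floor_add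
          of_nat_0_le_iff one_add_floor split_mult_pos_le zero_le_floor)
    then show ?thesis
    proof
      assume "j k t = j k s"
      then show ?thesis using gM[OF st(1)] D by (simp add: g_def)
    next
      assume e: "j k t = Suc (j k s)"
      then have "j k s < l k" using j[OF st(2), of k] by simp
      then show ?thesis using lz(6)[of "j k s" k] e by (simp add: g_def)
    qed
  qed
  have small: "\<exists>k. (4 * C + 1) * D / 2 ^ k < \<epsilon>" if "\<epsilon> > 0" for \<epsilon> :: real
  proof -
    have "(\<lambda>n. (4 * C + 1) * D / 2 ^ n) \<longlonglongrightarrow> 0"
      using tendsto_mult_right_zero[OF LIMSEQ_inverse_realpow_zero[of 2], of "(4 * C + 1) * D"] by (simp add: field_simps)
    from order_tendstoD(2)[OF this that] show ?thesis by (auto simp: eventually_sequentially)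
  qed
  \<comment> \<open>Two limit errors of \<open>2 * C * D / 2 ^ k\<close> each and one link of
    \<open>D / 2 ^ k\<close> add up to the constant \<open>4 * C + 1\<close>.\<close>
  have modulus: "d (\<gamma> s) (\<gamma> t) \<le> (4 * C + 1) * D / 2 ^ k"
    if st: "s \<in> {0..1}" "t \<in> {0..1}" "\<bar>s - t\<bar> < 1 / l k" for s t k
  proof -
    have "d (g k s) (g k t) \<le> D / 2 ^ k"
      using osc[of s t k] osc[of t s k] st commute[of "g k s" "g k t"] by linarith
    moreover have "d (\<gamma> s) (\<gamma> t) \<le> d (g k s) (\<gamma> s) + d (g k s) (g k t) + d (g k t) (\<gamma> t)"
      using triangle[of "\<gamma> s" "g k s" "\<gamma> t"] triangle[of "g k s" "g k t" "\<gamma> t"] gM \<gamma> st commute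
      by (smt (verit, best))
    moreover have "2 * (C * D) / 2 ^ k + D / 2 ^ k + 2 * (C * D) / 2 ^ k = (4 * C + 1) * D / 2 ^ k"
      by (simp add: field_simps)
    ultimately show ?thesis using lim[OF st(1), of k] lim[OF st(2), of k] by linarith
  qed
  have "continuous_map (top_of_set {0..1}) mtopology \<gamma>"
    unfolding continuous_map_to_metric
  proof (intro ballI allI impI)
    fix s \<epsilon> :: real assume s: "s \<in> topspace (top_of_set {0..1})" and "\<epsilon> > 0"
    then obtain k where k: "(4 * C + 1) * D / 2 ^ k < \<epsilon>" using small by blast
    have "\<gamma> t \<in> mball (\<gamma> s) \<epsilon>" if "t \<in> {0..1} \<inter> ball s (1 / l k)" for t
      using modulus[of s t k] k s that \<gamma> by (auto simp: dist_real_def)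
    moreover have "s \<in> ball s (1 / l k)" using lz(1)[of k] by simp
    ultimately show "\<exists>U. openin (top_of_set {0..1}) U \<and> s \<in> U \<and> (\<forall>y\<in>U. \<gamma> y \<in> mball (\<gamma> s) \<epsilon>)"
      using s by (intro exI[of _ "{0..1} \<inter> ball s (1 / l k)"]) (auto simp: openin_open_Int)
  qed
  moreover have "\<gamma> t = a" if a: "t \<in> {0..1}" "\<And>k. g k t = a" for t a
  proof (rule ccontr)
    assume "\<gamma> t \<noteq> a"
    then have "d a (\<gamma> t) > 0" using gM[OF a(1)] a \<gamma> by auto
    then obtain k where k: "(4 * C + 1) * D / 2 ^ k < d a (\<gamma> t)" using small by blast
    have "2 * (C * D) / 2 ^ k \<le> (4 * C + 1) * D / 2 ^ k"
      using D C by (intro divide_right_mono) (auto simp: algebra_simps)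
    then show False using lim[OF a(1), of k] k a(2) by auto
  qed
  from this[of 0 x] this[of 1 y] have "\<gamma> 0 = x" "\<gamma> 1 = y"
    using lz by (auto simp: g_def j_def)
  moreover have "d x (\<gamma> t) \<le> (4 * C + 1) * d x y" if t: "t \<in> {0..1}" for t
  proof -
    \<comment> \<open>At level 0 the step function takes only the values \<open>x\<close> and
      \<open>y\<close>, and the limit deviates from it by at most
      \<open>2 * C * D = 4 * C * d x y\<close>.\<close>
    have "j 0 t = 0 \<or> j 0 t = 1" using j[OF t, of 0] lz(4) by linarith
    then have "g 0 t = x \<or> g 0 t = y" using lz(2,3)[of 0] lz(4) by (auto simp: g_def)
    then have "d x (g 0 t) \<le> d x y" using xy by auto
    moreover have "d (g 0 t) (\<gamma> t) \<le> 4 * C * d x y" using lim[OF t, of 0] by (simp add: D_def)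
    ultimately show ?thesis
      using triangle[of x "g 0 t" "\<gamma> t"] gM[OF t] \<gamma>[OF t] xy by (simp add: algebra_simps)
  qed
  ultimately show ?thesis by blast
qed

section \<open>Arcs inside paths, and the diameter of arcs\<close>

text \<open>A point \<open>x\<close> goes to the function \<open>d x z - d a z\<close> of
  \<open>z\<close>. Subtracting the distance to a base point makes it bounded, the discrete topology
  makes it continuous, and the supremum distance between the images of \<open>x\<close> and
  \<open>y\<close> is attained at \<open>z = y\<close>.\<close>

lemma kuratowski_embedding:
  "\<exists>\<iota> :: 'a \<Rightarrow> ('a discrete \<Rightarrow>\<^sub>C real). \<forall>x\<in>M. \<forall>y\<in>M. dist (\<iota> x) (\<iota> y) = d x y"
proof (cases "M = {}")
  case False
  then obtain a where a: "a \<in> M" by blast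
  define h where "h x z = (if of_discrete z \<in> M then d x (of_discrete z) - d a (of_discrete z) else 0)" for x z
  have h: "h x \<in> bcontfun" if "x \<in> M" for x
  proof (rule bcontfun_normI)
    show "continuous_on UNIV (h x)"
      by (auto simp: continuous_on_open_invariant open_discrete)
    show "norm (h x z) \<le> d x a" for z
      using that a triangle[of x a "of_discrete z"] triangle[of a x "of_discrete z"] commute[of a x]
      by (auto simp: h_def)
  qed
  have val: "apply_bcontfun (Bcontfun (h x)) z = h x z" if "x \<in> M" for x z
    using h[OF that] by (simp add: Bcontfun_inverse)
  have "dist (Bcontfun (h x)) (Bcontfun (h y)) = d x y" if xy: "x \<in> M" "y \<in> M" for x y
  proof (rule antisym)
    show "dist (Bcontfun (h x)) (Bcontfun (h y)) \<le> d x y"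
    proof (rule dist_bound)
      fix z
      show "dist (apply_bcontfun (Bcontfun (h x)) z) (apply_bcontfun (Bcontfun (h y)) z) \<le> d x y"
        unfolding val[OF xy(1)] val[OF xy(2)]
        using xy triangle[of x y "of_discrete z"] triangle[of y x "of_discrete z"] commute[of x y]
        by (auto simp: h_def dist_real_def)
    qed
    have "d x y = dist (apply_bcontfun (Bcontfun (h x)) (discrete y)) (apply_bcontfun (Bcontfun (h y)) (discrete y))"
      unfolding val[OF xy(1)] val[OF xy(2)] using xy by (simp add: h_def dist_real_def discrete_inverse)
    also have "\<dots> \<le> dist (Bcontfun (h x)) (Bcontfun (h y))"
      by (rule dist_bounded)
    finally show "d x y \<le> dist (Bcontfun (h x)) (Bcontfun (h y))" .
  qed
  then show ?thesis by (intro exI[of _ "\<lambda>x. Bcontfun (h x)"]) blast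
qed simp

text \<open>The library extracts arcs from paths in Banach spaces only, hence the detour through the embedding.\<close>
lemma path_imp_arc_between:
  assumes \<gamma>: "continuous_map (top_of_set {0..1::real}) mtopology \<gamma>" and "\<gamma> 0 \<noteq> \<gamma> 1"
  shows "\<exists>A \<subseteq> \<gamma> ` {0..1}. is_arc_between M d A (\<gamma> 0) (\<gamma> 1)"
proof -
  obtain \<iota> :: "'a \<Rightarrow> ('a discrete \<Rightarrow>\<^sub>C real)" where \<iota>: "\<And>x y. x \<in> M \<Longrightarrow> y \<in> M \<Longrightarrow> dist (\<iota> x) (\<iota> y) = d x y"
    using kuratowski_embedding by blast
  have inj: "inj_on \<iota> M" using \<iota> by (metis dist_self inj_onI zero)
  have \<gamma>M: "\<gamma> t \<in> M" if "t \<in> {0..1}" for t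
    using \<gamma> that by (auto simp: continuous_map_def)
  have "path (\<iota> \<circ> \<gamma>)"
    unfolding path_def continuous_on_iff
  proof (intro ballI allI impI)
    fix s e :: real assume s: "s \<in> {0..1}" and "e > 0"
    then obtain U where U: "openin (top_of_set {0..1}) U" "s \<in> U" "\<forall>y\<in>U. \<gamma> y \<in> mball (\<gamma> s) e"
      using \<gamma> unfolding continuous_map_to_metric by (metis topspace_euclidean_subtopology)
    then obtain \<delta> where "\<delta> > 0" "\<And>t. t \<in> {0..1} \<Longrightarrow> dist t s < \<delta> \<Longrightarrow> t \<in> U"
      unfolding openin_euclidean_subtopology_iff by blast
    moreover have "dist (\<iota> (\<gamma> t)) (\<iota> (\<gamma> s)) < e" if "t \<in> {0..1}" "t \<in> U" for t
      using U(3) that s \<gamma>M commute[of "\<gamma> s" "\<gamma> t"] \<iota>[of "\<gamma> t" "\<gamma> s"] by auto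
    ultimately show "\<exists>\<delta>>0. \<forall>t\<in>{0..1}. dist t s < \<delta> \<longrightarrow> dist ((\<iota> \<circ> \<gamma>) t) ((\<iota> \<circ> \<gamma>) s) < e"
      by (metis comp_apply)
  qed
  moreover have "\<iota> (\<gamma> 0) \<noteq> \<iota> (\<gamma> 1)"
    using assms(2) inj \<gamma>M by (simp add: inj_on_eq_iff)
  ultimately obtain q where q: "arc q" "path_image q \<subseteq> path_image (\<iota> \<circ> \<gamma>)"
      "pathstart q = \<iota> (\<gamma> 0)" "pathfinish q = \<iota> (\<gamma> 1)"
    using path_contains_arc[of "\<iota> \<circ> \<gamma>" "\<iota> (\<gamma> 0)" "\<iota> (\<gamma> 1)"]
    by (auto simp: pathfinish_def pathstart_def)
  define h where "h = inv_into M \<iota> \<circ> q"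
  have qim: "q t \<in> \<iota> ` \<gamma> ` {0..1}" if "t \<in> {0..1}" for t
    using q(2) that by (auto simp: path_image_def image_comp)
  have h: "h t \<in> \<gamma> ` {0..1}" "\<iota> (h t) = q t" "h t \<in> M" if "t \<in> {0..1}" for t
    using qim[OF that] \<gamma>M inj by (auto simp: h_def)
  have "continuous_map (top_of_set {0..1}) mtopology h"
    unfolding continuous_map_to_metric
  proof (intro ballI allI impI)
    fix s e :: real assume s: "s \<in> topspace (top_of_set {0..1})" and "e > 0"
    moreover have "continuous_on {0..1} q" using q(1) by (simp add: arc_def path_def)
    ultimately obtain \<delta> where \<delta>: "\<delta> > 0" "\<And>t. t \<in> {0..1} \<Longrightarrow> dist t s < \<delta> \<Longrightarrow> dist (q t) (q s) < e"
      unfolding continuous_on_iff by (metis topspace_euclidean_subtopology)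
    have "h t \<in> mball (h s) e" if t: "t \<in> {0..1} \<inter> ball s \<delta>" for t
    proof -
      have "dist (q s) (q t) = d (h s) (h t)"
        using \<iota>[of "h s" "h t"] h s t by simp
      then show ?thesis using \<delta>(2)[of t] h s t by (simp add: dist_commute)
    qed
    then show "\<exists>U. openin (top_of_set {0..1}) U \<and> s \<in> U \<and> (\<forall>y\<in>U. h y \<in> mball (h s) e)"
      using s \<delta>(1) by (intro exI[of _ "{0..1} \<inter> ball s \<delta>"]) (auto simp: openin_open_Int)
  qed
  moreover have "inj_on h {0..1}"
    using q(1) h(2) unfolding arc_def by (metis inj_on_def)
  ultimately have "is_arc_between M d (h ` {0..1}) (h 0) (h 1)"
    using is_arc_between_image Metric_space_axioms by blast
  moreover have "h 0 = \<gamma> 0" "h 1 = \<gamma> 1"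
    using q(3,4) \<gamma>M inj by (auto simp: h_def pathstart_def pathfinish_def)
  ultimately show ?thesis using h(1) by (metis image_subsetI)
qed

end

text \<open>The path from bounded turning stays close to \<open>x\<close> and contains an arc from
  \<open>x\<close> to \<open>y\<close>; by uniqueness this is the given arc.\<close>

lemma bounded_turning_arcs:
  assumes "metric_tree T d" "bounded_turning T d"
  shows "\<exists>c\<ge>1. \<forall>x y A u. is_arc_between T d A x y \<and> x \<noteq> y \<and> u \<in> A \<longrightarrow> d x u \<le> c * d x y"
proof -
  interpret Metric_space T d using assms(1) by (simp add: metric_tree_def)
  have "mcomplete" using assms(1) compact_space_imp_mcomplete by (simp add: metric_tree_def)
  obtain C where C: "C \<ge> 1" "turning C"
    using assms(2) unfolding bounded_turning_def turning_def by metis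
  have "d x u \<le> (4 * C + 1) * d x y" if A: "is_arc_between T d A x y" and xy: "x \<noteq> y" and u: "u \<in> A" for x y A u
  proof -
    have T: "x \<in> T" "y \<in> T"
      using is_arc_between_connectedin[OF A Metric_space_axioms] A by (auto simp: is_arc_between_def)
    obtain \<gamma> where \<gamma>: "continuous_map (top_of_set {0..1::real}) mtopology \<gamma>" "\<gamma> 0 = x" "\<gamma> 1 = y"
           "\<forall>t\<in>{0..1}. d x (\<gamma> t) \<le> (4 * C + 1) * d x y"
      using turning_imp_path[OF \<open>mcomplete\<close> C(2) _ T xy] C(1) by auto
    obtain B where "B \<subseteq> \<gamma> ` {0..1}" "is_arc_between T d B x y"
      using path_imp_arc_between[OF \<gamma>(1)] \<gamma> xy by auto
    moreover have "A = B"
      using assms(1) T xy A calculation(2) unfolding metric_tree_def by blast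
    ultimately show ?thesis using u \<gamma>(4) by blast
  qed
  then show ?thesis using C(1) by (intro exI[of _ "4 * C + 1"]) auto
qed

section \<open>Combs\<close>

lemma (in Metric_space) continuous_map_Lipschitz_path:
  assumes "\<And>t. t \<in> {0..1} \<Longrightarrow> g t \<in> M"
    and "\<And>s t. s \<in> {0..1} \<Longrightarrow> t \<in> {0..1} \<Longrightarrow> d (g s) (g t) \<le> B * \<bar>s - t\<bar>"
  shows "continuous_map (top_of_set {0..1::real}) mtopology g"
  unfolding continuous_map_to_metric
proof (intro ballI allI impI)
  fix s e :: real assume s: "s \<in> topspace (top_of_set {0..1})" and "e > 0"
  define \<delta> where "\<delta> = e / (\<bar>B\<bar> + 1)"
  have \<delta>: "\<delta> > 0" using \<open>e > 0\<close> by (simp add: \<delta>_def)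
  have "d (g s) (g t) < e" if t: "t \<in> {0..1}" "\<bar>s - t\<bar> < \<delta>" for t
  proof -
    have "d (g s) (g t) \<le> B * \<bar>s - t\<bar>" using assms(2) s t by simp
    also have "\<dots> \<le> (\<bar>B\<bar> + 1) * \<bar>s - t\<bar>" by (intro mult_right_mono) auto
    also have "\<dots> < (\<bar>B\<bar> + 1) * \<delta>" using t(2) by (intro mult_strict_left_mono) auto
    also have "\<dots> = e" by (simp add: \<delta>_def)
    finally show ?thesis .
  qed
  then show "\<exists>U. openin (top_of_set {0..1}) U \<and> s \<in> U \<and> (\<forall>y\<in>U. g y \<in> mball (g s) e)"
    using s \<delta> assms(1) by (intro exI[of _ "{0..1} \<inter> ball s \<delta>"]) (auto simp: openin_open_Int dist_real_def)
qed

lemma (in Metric_space) continuous_map_Lipschitz_real: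
  assumes "\<And>s t. s \<in> M \<Longrightarrow> t \<in> M \<Longrightarrow> \<bar>f s - f t\<bar> \<le> B * d s t"
  shows "continuous_map mtopology euclideanreal f"
proof -
  have "\<exists>\<delta>>0. \<forall>x. x \<in> M \<and> d a x < \<delta> \<longrightarrow> dist (f a) (f x) < e" if "a \<in> M" "e > 0" for a e
  proof (intro exI[of _ "e / (\<bar>B\<bar> + 1)"] conjI allI impI)
    fix x assume x: "x \<in> M \<and> d a x < e / (\<bar>B\<bar> + 1)"
    have "\<bar>f a - f x\<bar> \<le> B * d a x" using assms x that by simp
    also have "\<dots> \<le> (\<bar>B\<bar> + 1) * d a x" by (intro mult_right_mono) auto
    also have "\<dots> < (\<bar>B\<bar> + 1) * (e / (\<bar>B\<bar> + 1))" using x by (intro mult_strict_left_mono) auto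
    finally show "dist (f a) (f x) < e" by (simp add: dist_real_def)
  qed (use that in simp)
  then show ?thesis
    using metric_continuous_map[OF Met_TC.Metric_space_axioms, of f] by simp
qed

lemma connectedin_IVT:
  fixes f :: "'a \<Rightarrow> real"
  assumes "continuous_map X euclideanreal f" "connectedin X K" "s \<in> K" "t \<in> K" "f s \<le> c" "c \<le> f t"
  shows "\<exists>u\<in>K. f u = c"
proof -
  have "connected (f ` K)"
    using connectedin_continuous_map_image[OF assms(1,2)] by simp
  then have "{f s..f t} \<subseteq> f ` K"
    using assms by (intro connected_contains_Icc) auto
  then show ?thesis using assms by force
qed

text \<open>Every component contains a nonempty member of the cover, and disjoint components contain
  different ones. Empty members are harmless, which helps at the ends of the base and of the
  teeth.\<close>

lemma card_connected_components_le:
  assumes "topspace X \<subseteq> \<Union>\<K>" "finite \<K>" "\<And>K. K \<in> \<K> \<Longrightarrow> connectedin X K"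
  shows "finite (connected_components_of X)" "card (connected_components_of X) \<le> card \<K>"
proof -
  have "\<exists>K\<in>\<K>. K \<noteq> {} \<and> K \<subseteq> C" if C: "C \<in> connected_components_of X" for C
  proof -
    obtain c where c: "c \<in> C" "c \<in> topspace X"
      using nonempty_connected_components_of[OF C] connected_components_of_subset[OF C] by blast
    then obtain K where "K \<in> \<K>" "c \<in> K" using assms(1) by blast
    then show ?thesis using connected_components_of_maximal[OF C assms(3)] c by (auto simp: disjnt_iff)
  qed
  then obtain k where k: "\<And>C. C \<in> connected_components_of X \<Longrightarrow> k C \<in> \<K> \<and> k C \<noteq> {} \<and> k C \<subseteq> C"
    by metis
  have "inj_on k (connected_components_of X)"
  proof (rule inj_onI)
    fix C C' assume C: "C \<in> connected_components_of X" "C' \<in> connected_components_of X" "k C = k C'"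
    then have "\<not> disjnt C C'" using k[of C] k[of C'] by (auto simp: disjnt_iff)
    then show "C = C'"
      using pairwise_disjoint_connected_components_of C by (meson pairwiseD)
  qed
  moreover have "k ` connected_components_of X \<subseteq> \<K>" using k by blast
  ultimately show "finite (connected_components_of X)" "card (connected_components_of X) \<le> card \<K>"
    using assms(2) by (meson inj_on_finite, meson card_inj_on_le)
qed

text \<open>The comb carries the path metric of the union of the base \<open>[0, 1] \<times> {0}\<close> and of the teeth
  \<open>{x} \<times> [0, H x]\<close>. Points are encoded through \<open>P\<close> with coordinates \<open>X\<close> and \<open>Y\<close>, because the carrier
  has to be a set of reals in the end.\<close>
locale comb =
  fixes P :: "real \<Rightarrow> real \<Rightarrow> 'b" and X Y :: "'b \<Rightarrow> real" and H :: "real \<Rightarrow> real"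
  assumes X_P [simp]: "X (P x y) = x" and Y_P [simp]: "Y (P x y) = y" and P_XY [simp]: "P (X s) (Y s) = s"
    and H_nonneg: "0 \<le> H x" and finite_H: "\<epsilon> > 0 \<Longrightarrow> finite {x. \<epsilon> \<le> H x}"
begin

section \<open>The path metric of a comb and its geodesic segments\<close>

lemma point_eqI: "X s = X t \<Longrightarrow> Y s = Y t \<Longrightarrow> s = t"
  by (metis P_XY)

definition S :: "'b set" where
  "S = {s. 0 \<le> X s \<and> X s \<le> 1 \<and> 0 \<le> Y s \<and> Y s \<le> H (X s)}"

text \<open>The absolute values keep \<open>d\<close> nonnegative off the comb too, where heights
  may be negative; \<open>Metric_space\<close> asks this of the whole type.\<close>

definition d :: "'b \<Rightarrow> 'b \<Rightarrow> real" where
  "d s t = (if X s = X t then \<bar>Y s - Y t\<bar> else \<bar>Y s\<bar> + \<bar>X s - X t\<bar> + \<bar>Y t\<bar>)"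

sublocale Metric_space S d
proof
  show "d s t = 0 \<longleftrightarrow> s = t" for s t
    using point_eqI[of s t] by (auto simp: d_def)
qed (auto simp: d_def)

lemma Y_nonneg: "s \<in> S \<Longrightarrow> 0 \<le> Y s"
  by (simp add: S_def)

lemma base_in_S: "0 \<le> x \<Longrightarrow> x \<le> 1 \<Longrightarrow> P x 0 \<in> S"
  by (simp add: S_def H_nonneg)

text \<open>The unit-speed geodesic: down one tooth, along the base and up the other tooth, or
  vertically inside a common tooth.\<close>

definition geo :: "'b \<Rightarrow> 'b \<Rightarrow> real \<Rightarrow> 'b" where
  "geo s t \<tau> =
     (if X s = X t then P (X s) (if Y s \<le> Y t then Y s + \<tau> else Y s - \<tau>)
      else if \<tau> \<le> Y s then P (X s) (Y s - \<tau>)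
      else if \<tau> \<le> Y s + \<bar>X s - X t\<bar> then P (if X s < X t then X s + (\<tau> - Y s) else X s - (\<tau> - Y s)) 0
      else P (X t) (\<tau> - Y s - \<bar>X s - X t\<bar>))"

definition seg :: "'b \<Rightarrow> 'b \<Rightarrow> 'b set" where
  "seg s t = geo s t ` {0..d s t}"

lemma geo_in_S:
  assumes "s \<in> S" "t \<in> S" "0 \<le> \<tau>" "\<tau> \<le> d s t"
  shows "geo s t \<tau> \<in> S"
  using assms H_nonneg unfolding S_def d_def geo_def by (auto split: if_splits simp: abs_if)

lemma geo_isometry:
  assumes "s \<in> S" "t \<in> S" "0 \<le> \<tau>" "\<tau> \<le> \<tau>'" "\<tau>' \<le> d s t"
  shows "d (geo s t \<tau>) (geo s t \<tau>') = \<tau>' - \<tau>"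
proof (cases "X s = X t")
  case True
  then show ?thesis using assms by (auto simp: geo_def d_def)
next
  case False
  define D where "D = \<bar>X s - X t\<bar>"
  have D: "D > 0" and Y: "0 \<le> Y s" "0 \<le> Y t" using False assms Y_nonneg by (auto simp: D_def)
  have \<tau>': "\<tau>' \<le> Y s + D + Y t" using assms False Y by (simp add: d_def D_def)
  \<comment> \<open>With the direction as a sign, every point of the geodesic has first coordinate
    \<open>X s + \<sigma> * a\<close> for an offset \<open>a\<close> in [0, \<open>D\<close>]. One
    formula \<open>dP\<close> then covers all pairs of pieces, and linear arithmetic
    remains.\<close>
  define \<sigma> where "\<sigma> = (if X s < X t then 1 else -1 :: real)"
  have \<sigma>: "\<bar>\<sigma> * a\<bar> = \<bar>a\<bar>" "X t = X s + \<sigma> * D" "\<sigma> * a = \<sigma> * b \<longleftrightarrow> a = b" for a b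
    using False by (auto simp: \<sigma>_def D_def)
  have g: "geo s t \<rho> = (if \<rho> \<le> Y s then P (X s) (Y s - \<rho>)
      else if \<rho> \<le> Y s + D then P (X s + \<sigma> * (\<rho> - Y s)) 0 else P (X t) (\<rho> - Y s - D))" for \<rho>
    using False by (auto simp: geo_def D_def \<sigma>_def algebra_simps)
  have dP: "d (P (X s + \<sigma> * a) y) (P (X s + \<sigma> * b) z) = (if a = b then \<bar>y - z\<bar> else \<bar>y\<bar> + \<bar>a - b\<bar> + \<bar>z\<bar>)" for a b y z
    using \<sigma>(1)[of "a - b"] \<sigma>(3) by (simp add: d_def right_diff_distrib)
  have g': "geo s t \<rho> = (if \<rho> \<le> Y s then P (X s + \<sigma> * 0) (Y s - \<rho>)
      else if \<rho> \<le> Y s + D then P (X s + \<sigma> * (\<rho> - Y s)) 0 else P (X s + \<sigma> * D) (\<rho> - Y s - D))" for \<rho>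
    unfolding g \<sigma>(2) by simp
  show ?thesis
    using assms(3,4) \<tau>' Y D unfolding g'
    by (cases "\<tau> \<le> Y s"; cases "\<tau>' \<le> Y s"; cases "\<tau> \<le> Y s + D"; cases "\<tau>' \<le> Y s + D")
      (simp_all only: if_True if_False dP, simp_all)
qed

lemma geo_dist:
  assumes "s \<in> S" "t \<in> S" "\<tau> \<in> {0..d s t}" "\<tau>' \<in> {0..d s t}"
  shows "d (geo s t \<tau>) (geo s t \<tau>') = \<bar>\<tau>' - \<tau>\<bar>"
  using geo_isometry[of s t \<tau> \<tau>'] geo_isometry[of s t \<tau>' \<tau>] assms commute
  by (cases "\<tau> \<le> \<tau>'") auto

lemma geo_ends [simp]:
  assumes "s \<in> S" "t \<in> S"
  shows "geo s t 0 = s" "geo s t (d s t) = t"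
  using assms unfolding S_def d_def geo_def by (auto intro!: point_eqI split: if_splits simp: abs_if)

lemma seg_cases:
  assumes "s \<in> S" "t \<in> S" "u \<in> seg s t"
  shows "X s = X t \<and> X u = X s \<and> (Y s \<le> Y u \<and> Y u \<le> Y t \<or> Y t \<le> Y u \<and> Y u \<le> Y s) \<or>
    X s \<noteq> X t \<and> (X u = X s \<and> 0 \<le> Y u \<and> Y u \<le> Y s \<or>
      Y u = 0 \<and> (X s \<le> X u \<and> X u \<le> X t \<or> X t \<le> X u \<and> X u \<le> X s) \<or>
      X u = X t \<and> 0 \<le> Y u \<and> Y u \<le> Y t)"
proof -
  obtain \<tau> where \<tau>: "0 \<le> \<tau>" "\<tau> \<le> d s t" and u: "u = geo s t \<tau>"
    using assms(3) by (auto simp: seg_def)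
  have Y: "0 \<le> Y s" "0 \<le> Y t" using assms Y_nonneg by auto
  show ?thesis
  proof (cases "X s = X t")
    case True
    then show ?thesis using \<tau> Y by (auto simp: u geo_def d_def)
  next
    case False
    then show ?thesis using \<tau> Y unfolding u geo_def d_def
      by (cases "\<tau> \<le> Y s"; cases "\<tau> \<le> Y s + \<bar>X s - X t\<bar>"; cases "X s < X t") simp_all
  qed
qed

lemma seg_subset: "s \<in> S \<Longrightarrow> t \<in> S \<Longrightarrow> seg s t \<subseteq> S"
  using geo_in_S by (auto simp: seg_def)

lemma ends_in_seg: "s \<in> S \<Longrightarrow> t \<in> S \<Longrightarrow> s \<in> seg s t \<and> t \<in> seg s t"
  unfolding seg_def by (metis atLeastAtMost_iff geo_ends imageI nonneg order_refl)

text \<open>This passage through the foot later forces the arcs between image points to come near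
  the image of \<open>p\<close>.\<close>

lemma foot_in_seg: "s \<in> S \<Longrightarrow> t \<in> S \<Longrightarrow> X s \<noteq> X t \<Longrightarrow> P (X s) 0 \<in> seg s t"
  unfolding seg_def by (rule image_eqI[of _ _ "Y s"]) (auto simp: geo_def d_def S_def)

lemma seg_diameter:
  assumes "s \<in> S" "t \<in> S" "u \<in> seg s t" "v \<in> seg s t"
  shows "d u v \<le> d s t"
  using assms geo_dist[OF assms(1,2)] by (auto simp: seg_def)

lemma seg_path:
  assumes "s \<in> S" "t \<in> S"
  defines "g \<equiv> \<lambda>\<theta>. geo s t (\<theta> * d s t)"
  shows "continuous_map (top_of_set {0..1}) mtopology g" "g ` {0..1} = seg s t" "g 0 = s" "g 1 = t"
    "s \<noteq> t \<Longrightarrow> inj_on g {0..1}"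
proof -
  have sc: "\<theta> * d s t \<in> {0..d s t}" if "\<theta> \<in> {0..1}" for \<theta>
    using that by (auto simp: mult_left_le_one_le)
  have dg: "d (g \<theta>) (g \<theta>') = d s t * \<bar>\<theta> - \<theta>'\<bar>" if "\<theta> \<in> {0..1}" "\<theta>' \<in> {0..1}" for \<theta> \<theta>'
    unfolding g_def using geo_dist[OF assms(1,2) sc[OF that(1)] sc[OF that(2)]]
    by (simp add: abs_mult abs_minus_commute flip: left_diff_distrib)
  have gS: "g \<theta> \<in> S" if "\<theta> \<in> {0..1}" for \<theta>
    using geo_in_S[OF assms(1,2)] sc[OF that] by (simp add: g_def)
  show "continuous_map (top_of_set {0..1}) mtopology g"
    using gS dg by (intro continuous_map_Lipschitz_path[where B = "d s t"]) auto
  show "g 0 = s" "g 1 = t" using assms by auto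
  show "g ` {0..1} = seg s t"
  proof
    show "g ` {0..1} \<subseteq> seg s t" unfolding g_def seg_def using sc by blast
    show "seg s t \<subseteq> g ` {0..1}"
    proof (cases "s = t")
      case True
      then show ?thesis using assms by (force simp: seg_def)
    next
      case False
      then have p: "d s t > 0" using assms by simp
      have "geo s t \<tau> = g (\<tau> / d s t)" "\<tau> / d s t \<in> {0..1}" if "\<tau> \<in> {0..d s t}" for \<tau>
        using p that by (auto simp: g_def)
      then show ?thesis unfolding seg_def by blast
    qed
  qed
  show "inj_on g {0..1}" if "s \<noteq> t"
  proof (rule inj_onI)
    fix a b assume ab: "a \<in> {0..1}" "b \<in> {0..1}" "g a = g b"
    then have "d s t * \<bar>a - b\<bar> = 0" using dg gS by (metis zero)
    then show "a = b" using that assms(1,2) by simp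
  qed
qed

lemma connectedin_seg: "s \<in> S \<Longrightarrow> t \<in> S \<Longrightarrow> connectedin mtopology (seg s t)"
  using connectedin_continuous_map_image[OF seg_path(1), of s t "{0..1}"] seg_path(2)
  by (simp add: connectedin_subtopology)

lemma compactin_seg: "s \<in> S \<Longrightarrow> t \<in> S \<Longrightarrow> compactin mtopology (seg s t)"
  using image_compactin[OF _ seg_path(1), of "{0..1}" s t] seg_path(2)
  by (simp add: compactin_subtopology)

lemma is_arc_between_seg: "s \<in> S \<Longrightarrow> t \<in> S \<Longrightarrow> s \<noteq> t \<Longrightarrow> is_arc_between S d (seg s t) s t"
  using is_arc_between_image[OF Metric_space_axioms seg_path(1,5), of s t] seg_path(2,3,4)[of s t] by simp

lemma starlike_connectedin:
  assumes "c \<in> U" "U \<subseteq> S" "\<And>t. t \<in> U \<Longrightarrow> seg c t \<subseteq> U"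
  shows "connectedin mtopology U"
proof -
  have "t \<in> seg c t" if "t \<in> U" for t
    using assms(1,2) ends_in_seg that by blast
  then have "U = \<Union> (seg c ` U)"
    using assms(3) by blast
  moreover have "connectedin mtopology (\<Union> (seg c ` U))"
  proof (rule connectedin_Union)
    have "c \<in> seg c t" if "t \<in> U" for t
      using assms(1,2) ends_in_seg that by blast
    then show "\<Inter> (seg c ` U) \<noteq> {}" by blast
    show "connectedin mtopology K" if "K \<in> seg c ` U" for K
      using that assms(1,2) connectedin_seg by blast
  qed
  ultimately show ?thesis by simp
qed

text \<open>A 1-Lipschitz function that vanishes off the tooth at \<open>x\<close>. Together with \<open>X\<close> it separates the
  complement of a point, which gives the uniqueness of arcs by the intermediate value theorem.\<close>
definition height :: "real \<Rightarrow> 'b \<Rightarrow> real" where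
  "height x v = (if X v = x then Y v else 0)"

section \<open>Connected subsets and uniqueness of arcs\<close>

lemma continuous_map_X: "continuous_map mtopology euclideanreal X"
  by (rule continuous_map_Lipschitz_real[of _ 1]) (auto simp: d_def)

lemma continuous_map_height: "continuous_map mtopology euclideanreal (height x)"
  by (rule continuous_map_Lipschitz_real[of _ 1]) (auto simp: d_def height_def)

text \<open>The sum and the difference of \<open>X v - x\<close> and \<open>height x v\<close> both
  vanish only at the foot of the tooth at \<open>x\<close>. As \<open>a\<close> or \<open>b\<close>
  may lie on that tooth, the sign is chosen so that the function is at most 0 at \<open>a\<close>
  and at least 0 at \<open>b\<close>.\<close>

lemma foot_in_connected:
  assumes K: "connectedin mtopology K" "a \<in> K" "b \<in> K" and x: "X a < X b" "X a \<le> x" "x \<le> X b"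
  shows "P x 0 \<in> K"
proof -
  have KS: "K \<subseteq> S" using K by (simp add: connectedin_def)
  have Y: "0 \<le> Y a" "0 \<le> Y b" using KS K Y_nonneg by auto
  have eq: "v = P x 0" if "(X v - x) - height x v = 0 \<or> (X v - x) + height x v = 0" for v
    using that by (auto intro!: point_eqI simp: height_def split: if_splits)
  have c: "continuous_map mtopology euclideanreal (\<lambda>v. (X v - x) - height x v)"
       "continuous_map mtopology euclideanreal (\<lambda>v. (X v - x) + height x v)"
    by (intro continuous_map_diff continuous_map_add continuous_map_X continuous_map_height continuous_map_const[THEN iffD2]; simp)+
  show ?thesis
  proof (cases "x < X b")
    case True
    then have "\<exists>v\<in>K. (X v - x) - height x v = 0"
      using Y x by (intro connectedin_IVT[OF c(1) K]) (auto simp: height_def)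
    then show ?thesis using eq by blast
  next
    case False
    then have "\<exists>v\<in>K. (X v - x) + height x v = 0"
      using Y x by (intro connectedin_IVT[OF c(2) K]) (auto simp: height_def)
    then show ?thesis using eq by blast
  qed
qed

text \<open>A positive value \<open>Y u\<close> of \<open>height (X u)\<close> is attained only at
  \<open>u\<close>. The hypothesis on \<open>a\<close> covers both a lower point of the same tooth
  and any point off it.\<close>

lemma tooth_in_connected:
  assumes K: "connectedin mtopology K" "a \<in> K" "b \<in> K"
    and "X b = X u" "height (X u) a \<le> Y u" "Y u \<le> Y b" "0 < Y u"
  shows "u \<in> K"
proof -
  have "\<exists>v\<in>K. height (X u) v = Y u"
    using assms by (intro connectedin_IVT[OF continuous_map_height K]) (auto simp: height_def)
  then obtain v where "v \<in> K" "height (X u) v = Y u" by blast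
  moreover have "v = u"
    using \<open>0 < Y u\<close> calculation(2) by (intro point_eqI) (auto simp: height_def split: if_splits)
  ultimately show ?thesis by simp
qed

lemma seg_subset_connected:
  assumes K: "connectedin mtopology K" and st: "s \<in> K" "t \<in> K"
  shows "seg s t \<subseteq> K"
proof
  fix u assume u: "u \<in> seg s t"
  have S: "s \<in> S" "t \<in> S" using K st by (auto simp: connectedin_def)
  have Y: "0 \<le> Y s" "0 \<le> Y t" using S Y_nonneg by auto
  have u': "u = P (X u) (Y u)" by simp
  show "u \<in> K"
  proof (cases "X s = X t")
    case True
    then have b: "X u = X s" "Y s \<le> Y u \<and> Y u \<le> Y t \<or> Y t \<le> Y u \<and> Y u \<le> Y s" using seg_cases[OF S u] by auto
    show ?thesis
    proof (cases "Y u = 0")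
      case 0: True
      then have "u = s \<or> u = t" using b Y True by (auto intro: point_eqI)
      then show ?thesis using st by blast
    next
      case False
      then have "0 < Y u" using Y b by linarith
      then show ?thesis
        using b True tooth_in_connected[OF K st, of u] tooth_in_connected[OF K st(2,1), of u] Y
        by (auto simp: height_def)
    qed
  next
    case False
    then consider (s) "X u = X s" "0 < Y u" "Y u \<le> Y s" | (t) "X u = X t" "0 < Y u" "Y u \<le> Y t" |
       (b) "Y u = 0" "X s \<le> X u \<and> X u \<le> X t \<or> X t \<le> X u \<and> X u \<le> X s"
      using seg_cases[OF S u] by fastforce
    then show ?thesis
    proof cases
      case s
      then show ?thesis using tooth_in_connected[OF K st(2,1), of u] False by (simp add: height_def)
    next
      case t
      then show ?thesis using tooth_in_connected[OF K st, of u] False by (simp add: height_def)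
    next
      case b
      then show ?thesis
        using foot_in_connected[OF K st, of "X u"] foot_in_connected[OF K st(2,1), of "X u"] False u'
        by (metis linorder_neqE_linordered_idom order.strict_trans1 order_less_irrefl)
    qed
  qed
qed

text \<open>Any arc is connected, hence contains the segment between its endpoints, and
  irreducibility gives equality.\<close>

lemma unique_arc:
  assumes "s \<in> S" "t \<in> S" "s \<noteq> t"
  shows "\<exists>!A. is_arc_between S d A s t"
proof (rule ex1I)
  show "is_arc_between S d (seg s t) s t" by (rule is_arc_between_seg[OF assms])
  fix A assume A: "is_arc_between S d A s t"
  note con = is_arc_between_connectedin[OF A Metric_space_axioms]
  show "A = seg s t"
    using is_arc_between_irreducible[OF A Metric_space_axioms connectedin_seg seg_subset_connected[OF con]]
      assms ends_in_seg by simp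
qed

section \<open>Connectedness, local connectedness and compactness\<close>

lemma connected_S: "connected_space mtopology"
proof -
  have "connectedin mtopology S"
    using base_in_S seg_subset by (intro starlike_connectedin[of "P 0 0"]) auto
  then show ?thesis using connectedin_topspace[of mtopology] by simp
qed

lemma locally_connected_S: "locally_connected_space mtopology"
  unfolding locally_connected_space
proof (intro allI impI)
  fix V x assume "openin mtopology V \<and> x \<in> V"
  then obtain r where r: "r > 0" "mball x r \<subseteq> V" "x \<in> S"
    unfolding openin_mtopology by blast
  have "connectedin mtopology (mball x r)"
  proof (rule starlike_connectedin)
    show "seg x t \<subseteq> mball x r" if "t \<in> mball x r" for t
    proof
      fix u assume u: "u \<in> seg x t"
      have "d x u \<le> d x t"
        using seg_diameter[of x t x u] ends_in_seg[of x t] that u by auto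
      then show "u \<in> mball x r" using that u seg_subset[of x t] by auto
    qed
  qed (use r in auto)
  then show "\<exists>U. openin mtopology U \<and> connectedin mtopology U \<and> x \<in> U \<and> U \<subseteq> V"
    using r by (intro exI[of _ "mball x r"]) auto
qed

lemma heights_bounded: "\<exists>B. \<forall>x. H x \<le> B"
proof -
  have "finite (H ` {x. 1 \<le> H x})" using finite_H[of 1] by simp
  then obtain B where "\<And>x. 1 \<le> H x \<Longrightarrow> H x \<le> B"
    using bdd_above_finite unfolding bdd_above_def by (metis imageI mem_Collect_eq)
  then show ?thesis by (intro exI[of _ "max 1 B"]) (meson le_max_iff_disj linear)
qed

text \<open>A subsequence converges in the plane to some \<open>(a, b)\<close>. If
  \<open>b = 0\<close>, the path metric to the limit is dominated by the coordinate differences. If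
  \<open>b > 0\<close>, only finitely many teeth reach \<open>b / 2\<close>, so the subsequence ends
  up on the tooth at \<open>a\<close>.\<close>

lemma compact_S: "compact_space mtopology"
  unfolding compact_space_sequentially
proof (intro allI impI)
  fix \<sigma> :: "nat \<Rightarrow> 'b" assume "range \<sigma> \<subseteq> S"
  then have \<sigma>: "\<sigma> n \<in> S" for n by blast
  obtain B where B: "\<And>x. H x \<le> B" using heights_bounded by blast
  have "compact ({0..1} \<times> {0..B} :: (real \<times> real) set)" by (intro compact_Times) auto
  moreover have "\<forall>n. (X (\<sigma> n), Y (\<sigma> n)) \<in> {0..1} \<times> {0..B}"
    using \<sigma> B order_trans by (fastforce simp: S_def)
  ultimately obtain p r where p: "p \<in> {0..1} \<times> {0..B}" and r: "strict_mono r"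
      and lim: "((\<lambda>n. (X (\<sigma> n), Y (\<sigma> n))) \<circ> r) \<longlonglongrightarrow> p"
    unfolding compact_def by meson
  obtain a b where ab: "p = (a, b)" by fastforce
  have lX: "(\<lambda>n. X (\<sigma> (r n))) \<longlonglongrightarrow> a" and lY: "(\<lambda>n. Y (\<sigma> (r n))) \<longlonglongrightarrow> b"
    using tendsto_fst[OF lim] tendsto_snd[OF lim] ab by (simp_all add: o_def)
  have a: "0 \<le> a" "a \<le> 1" and b: "0 \<le> b" using p ab by auto
  have "limitin mtopology (\<sigma> \<circ> r) (P a b) sequentially \<and> P a b \<in> S"
  proof (cases "b = 0")
    case True
    have S: "P a 0 \<in> S" using a by (rule base_in_S)
    have "(\<lambda>n. \<bar>X (\<sigma> (r n)) - a\<bar> + \<bar>Y (\<sigma> (r n))\<bar>) \<longlonglongrightarrow> \<bar>a - a\<bar> + \<bar>0\<bar>"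
      using lX lY True by (intro tendsto_intros) auto
    then have z: "(\<lambda>n. \<bar>X (\<sigma> (r n)) - a\<bar> + \<bar>Y (\<sigma> (r n))\<bar>) \<longlonglongrightarrow> 0" by simp
    have le: "d (\<sigma> (r n)) (P a 0) \<le> \<bar>X (\<sigma> (r n)) - a\<bar> + \<bar>Y (\<sigma> (r n))\<bar>" for n by (auto simp: d_def)
    have "\<forall>\<^sub>F n in sequentially. d (\<sigma> (r n)) (P a 0) < e" if "e > 0" for e
      using order_tendstoD(2)[OF z that] le by (auto elim!: eventually_mono intro: le_less_trans)
    then show ?thesis using S True \<sigma> by (auto simp: limitin_metric)
  next
    case False
    then have b0: "b > 0" using b by simp
    \<comment> \<open>The other teeth that reach \<open>b / 2\<close>: a finite set, hence closed,
      that misses \<open>a\<close>.\<close>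
    define F where "F = {x. b / 2 \<le> H x} - {a}"
    have fin: "finite F" using finite_H[of "b / 2"] b0 by (simp add: F_def)
    have "\<forall>\<^sub>F n in sequentially. b / 2 < Y (\<sigma> (r n))"
      using order_tendstoD(1)[OF lY, of "b / 2"] b0 by simp
    moreover have "\<forall>\<^sub>F n in sequentially. X (\<sigma> (r n)) \<notin> F"
    proof -
      have "open (- F)" "a \<in> - F" using fin by (simp add: open_Compl finite_imp_closed, simp add: F_def)
      then show ?thesis using topological_tendstoD[OF lX, of "- F"] by simp
    qed
    ultimately have ev: "\<forall>\<^sub>F n in sequentially. X (\<sigma> (r n)) = a"
    proof eventually_elim
      case (elim n)
      then show ?case using \<sigma>[of "r n"] by (simp add: F_def S_def)
    qed
    then have "\<forall>\<^sub>F n in sequentially. Y (\<sigma> (r n)) \<le> H a"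
    proof eventually_elim
      case (elim n)
      then show ?case using \<sigma>[of "r n"] by (simp add: S_def)
    qed
    then have "b \<le> H a" using tendsto_upperbound[OF lY] by simp
    then have S: "P a b \<in> S" using a b by (simp add: S_def)
    have "\<forall>\<^sub>F n in sequentially. d (\<sigma> (r n)) (P a b) < e" if "e > 0" for e
      using ev tendstoD[OF lY that]
      by eventually_elim (simp add: d_def dist_real_def)
    then show ?thesis using S \<sigma> by (auto simp: limitin_metric)
  qed
  then show "\<exists>l r. l \<in> S \<and> strict_mono r \<and> limitin mtopology (\<sigma> \<circ> r) l sequentially"
    using r by blast
qed

lemma metric_tree_S: "metric_tree S d"
proof -
  have "P 0 0 \<noteq> P 1 0" by (metis X_P zero_neq_one)
  then show ?thesis
    unfolding metric_tree_def
    using Metric_space_axioms compact_S connected_S locally_connected_S unique_arc base_in_S[of 0] base_in_S[of 1]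
    by auto
qed

lemma bounded_turning_S: "bounded_turning S d"
  unfolding bounded_turning_def
  using seg_subset ends_in_seg compactin_seg connectedin_seg seg_diameter
  by (intro exI[of _ 1] conjI ballI order_refl) (metis mult_1)

section \<open>Valence\<close>

lemma connectedin_branch:
  assumes "U \<subseteq> S" "\<And>s t. s \<in> U \<Longrightarrow> t \<in> U \<Longrightarrow> seg s t \<subseteq> U"
  shows "connectedin mtopology U"
proof (cases "U = {}")
  case False
  then obtain c where "c \<in> U" by blast
  then show ?thesis using assms starlike_connectedin[of c U] by blast
qed simp

text \<open>Removing a base point leaves the parts to its left, to its right and above it. Removing
  an inner point or tip of a tooth leaves the part above it and the rest, which is starlike about
  the foot.\<close>

lemma valence_S: "valence S d \<le> 3"
  unfolding valence_def
proof (rule SUP_least)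
  fix p assume p: "p \<in> S"
  have "\<exists>\<K>. finite \<K> \<and> card \<K> \<le> 3 \<and> S - {p} = \<Union>\<K> \<and> (\<forall>K\<in>\<K>. connectedin mtopology K)"
  proof (cases "Y p = 0")
    case True
    have eq: "S - {p} = \<Union> {{s\<in>S. X s < X p}, {s\<in>S. X p < X s}, {s\<in>S. X s = X p \<and> Y s > 0}}"
      using True by (auto intro: point_eqI simp: S_def)
    have "connectedin mtopology {s\<in>S. X s < X p}"
    proof (rule connectedin_branch)
      fix s t assume "s \<in> {s\<in>S. X s < X p}" "t \<in> {s\<in>S. X s < X p}"
      then show "seg s t \<subseteq> {s\<in>S. X s < X p}"
        using seg_cases[of s t] seg_subset[of s t] by fastforce
    qed blast
    moreover have "connectedin mtopology {s\<in>S. X p < X s}"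
    proof (rule connectedin_branch)
      fix s t assume "s \<in> {s\<in>S. X p < X s}" "t \<in> {s\<in>S. X p < X s}"
      then show "seg s t \<subseteq> {s\<in>S. X p < X s}"
        using seg_cases[of s t] seg_subset[of s t] by fastforce
    qed blast
    moreover have "connectedin mtopology {s\<in>S. X s = X p \<and> Y s > 0}"
    proof (rule connectedin_branch)
      fix s t assume "s \<in> {s\<in>S. X s = X p \<and> Y s > 0}" "t \<in> {s\<in>S. X s = X p \<and> Y s > 0}"
      then show "seg s t \<subseteq> {s\<in>S. X s = X p \<and> Y s > 0}"
        using seg_cases[of s t] seg_subset[of s t] by fastforce
    qed blast
    ultimately show ?thesis
      by (intro exI[of _ "{{s\<in>S. X s < X p}, {s\<in>S. X p < X s}, {s\<in>S. X s = X p \<and> Y s > 0}}"] conjI eq) (auto simp: card_insert_if)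
  next
    case False
    then have y: "Y p > 0" using p Y_nonneg[of p] by simp
    have eq: "S - {p} = \<Union> {{s\<in>S. X s = X p \<and> Y s > Y p}, {s\<in>S. \<not> (X s = X p \<and> Y s \<ge> Y p)}}"
      by (auto intro: point_eqI)
    have "connectedin mtopology {s\<in>S. X s = X p \<and> Y s > Y p}"
    proof (rule connectedin_branch)
      fix s t assume "s \<in> {s\<in>S. X s = X p \<and> Y s > Y p}" "t \<in> {s\<in>S. X s = X p \<and> Y s > Y p}"
      then show "seg s t \<subseteq> {s\<in>S. X s = X p \<and> Y s > Y p}"
        using seg_cases[of s t] seg_subset[of s t] by fastforce
    qed blast
    moreover have "connectedin mtopology {s\<in>S. \<not> (X s = X p \<and> Y s \<ge> Y p)}"
    proof (rule starlike_connectedin)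
      show c: "P (X p) 0 \<in> {s\<in>S. \<not> (X s = X p \<and> Y s \<ge> Y p)}"
        using p y base_in_S by (simp add: S_def)
      fix t assume "t \<in> {s\<in>S. \<not> (X s = X p \<and> Y s \<ge> Y p)}"
      then show "seg (P (X p) 0) t \<subseteq> {s\<in>S. \<not> (X s = X p \<and> Y s \<ge> Y p)}"
        using seg_cases[of "P (X p) 0" t] seg_subset[of "P (X p) 0" t] c y by fastforce
    qed blast
    ultimately show ?thesis
      by (intro exI[of _ "{{s\<in>S. X s = X p \<and> Y s > Y p}, {s\<in>S. \<not> (X s = X p \<and> Y s \<ge> Y p)}}"] conjI eq) (auto simp: card_insert_if)
  qed
  then obtain \<K> where K: "finite \<K>" "card \<K> \<le> 3" "S - {p} = \<Union>\<K>" "\<forall>K\<in>\<K>. connectedin mtopology K"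
    by (elim exE conjE) (rule that)
  have "topspace (subtopology mtopology (S - {p})) \<subseteq> \<Union>\<K>" using K by simp
  note fin = card_connected_components_le[OF this K(1)]
  have con: "connectedin (subtopology mtopology (S - {p})) K" if "K \<in> \<K>" for K
    using K that by (auto simp: connectedin_subtopology)
  have "card (connected_components_of (subtopology mtopology (S - {p}))) \<le> 3"
    using fin(2)[OF con] K(2) by linarith
  moreover note fin(1)[OF con]
  ultimately show "valence_at S d p \<le> 3"
    unfolding valence_at_def Let_def by (simp add: numeral_eq_enat)
qed

end

section \<open>Combs with many long close teeth\<close>

text \<open>Factorials make the ratio of consecutive terms tend to 0. The terms serve both as
  positions and as lengths.\<close>

definition tooth :: "nat \<Rightarrow> real" where
  "tooth j = 1 / fact (Suc j)"

text \<open>The tooth at \<open>tooth j\<close> is as long as the position \<open>n\<close> indices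
  earlier; truncated subtraction gives the first ones the length \<open>tooth 0 = 1\<close>.\<close>

definition tooth_height :: "nat \<Rightarrow> real \<Rightarrow> real" where
  "tooth_height n x = (if x \<in> range tooth then tooth (inv tooth x - n) else 0)"

lemma tooth_pos: "0 < tooth j"
  by (simp add: tooth_def)

lemma tooth_Suc: "tooth (Suc j) = tooth j / (real j + 2)"
  by (simp add: tooth_def add.commute)

lemma tooth_Suc_le: "tooth (Suc j) \<le> tooth j / 2"
  unfolding tooth_Suc using tooth_pos[of j] by (intro divide_left_mono) auto

lemma tooth_antimono: "i \<le> j \<Longrightarrow> tooth j \<le> tooth i"
  by (rule lift_Suc_antimono_le[of tooth]) (use tooth_Suc_le tooth_pos in \<open>smt (verit) field_sum_of_halves\<close>)

lemma tooth_gap: "i < j \<Longrightarrow> tooth j \<le> tooth i / 2"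
  using tooth_antimono[of "Suc i" j] tooth_Suc_le[of i] by simp

lemma tooth_le_1: "tooth j \<le> 1"
  using tooth_antimono[of 0 j] by (simp add: tooth_def)

lemma inj_tooth: "inj tooth"
proof (rule linorder_injI)
  show "tooth i \<noteq> tooth j" if "i < j" for i j
    using tooth_gap[OF that] tooth_pos[of i] by auto
qed

lemma tooth_height_tooth [simp]: "tooth_height n (tooth j) = tooth (j - n)"
  by (simp add: tooth_height_def inj_tooth)

lemma tooth_height_nonneg: "0 \<le> tooth_height n x"
  by (auto simp: tooth_height_def intro: less_imp_le tooth_pos)

lemma tooth_le_inverse: "tooth j \<le> 1 / (real j + 1)"
proof -
  have "real (Suc j) \<le> fact (Suc j)"
    using fact_ge_self[of "Suc j"] by (metis of_nat_fact of_nat_le_iff)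
  then show ?thesis unfolding tooth_def by (intro divide_left_mono) (auto simp: add.commute)
qed

lemma finite_tooth_height:
  assumes "\<epsilon> > 0"
  shows "finite {x. \<epsilon> \<le> tooth_height n x}"
proof -
  obtain m :: nat where m: "1 / \<epsilon> < m" using reals_Archimedean2 by blast
  have "j \<le> m + n" if "\<epsilon> \<le> tooth (j - n)" for j
  proof (rule ccontr)
    assume "\<not> j \<le> m + n"
    then have "real m \<le> real (j - n)" by linarith
    moreover have "\<epsilon> \<le> 1 / (real (j - n) + 1)" using that tooth_le_inverse order_trans by blast
    then have "real (j - n) + 1 \<le> 1 / \<epsilon>" using assms by (simp add: field_simps)
    ultimately show False using m by linarith
  qed
  then have "{x. \<epsilon> \<le> tooth_height n x} \<subseteq> tooth ` {..m + n}"
    using assms by (auto simp: tooth_height_def inj_tooth split: if_splits)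
  then show ?thesis using finite_surj by blast
qed

text \<open>The \<open>n\<close> teeth after the \<open>j\<close>-th one have length at least \<open>tooth j\<close>, but stand within \<open>tooth (Suc j)\<close> of
  each other and \<open>tooth (Suc j) / tooth j\<close> tends to 0. At no scale are there more than \<open>n\<close> such teeth,
  which is what keeps the comb doubling.\<close>
lemma card_long_close_teeth:
  assumes "0 < \<rho>"
  shows "card {x. x < \<rho> \<and> \<rho> \<le> tooth_height n x} \<le> n \<and> finite {x. x < \<rho> \<and> \<rho> \<le> tooth_height n x}"
proof -
  let ?F = "{x. x < \<rho> \<and> \<rho> \<le> tooth_height n x}"
  \<comment> \<open>The first position below \<open>\<rho>\<close>. A tooth \<open>j\<close> in the
    set has \<open>j0 \<le> j\<close>, and its length is at least \<open>\<rho>\<close> only if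
    \<open>j < j0 + n\<close>.\<close>
  define j0 where "j0 = (LEAST j. tooth j < \<rho>)"
  have "?F \<subseteq> tooth ` {j0..<j0 + n}"
  proof
    fix x assume x: "x \<in> ?F"
    then obtain j where j: "x = tooth j"
      using assms by (auto simp: tooth_height_def split: if_splits)
    have xj: "tooth j < \<rho>" "\<rho> \<le> tooth (j - n)" using x by (auto simp: j)
    have "j0 \<le> j" "tooth j0 < \<rho>"
      unfolding j0_def using xj(1) by (auto intro: Least_le LeastI)
    moreover have "j < j0 + n"
    proof (rule ccontr)
      assume "\<not> j < j0 + n"
      then have "tooth (j - n) \<le> tooth j0" by (intro tooth_antimono) linarith
      then show False using xj calculation by linarith
    qed
    ultimately show "x \<in> tooth ` {j0..<j0 + n}" using j by auto
  qed
  then have "card ?F \<le> card (tooth ` {j0..<j0 + n})" "finite ?F"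
    by (auto intro: card_mono finite_subset)
  then show ?thesis using card_image_le[of "{j0..<j0 + n}" tooth] by simp
qed

section \<open>Doubling of the comb\<close>

lemma (in comb) doubling_S:
  assumes H: "H = tooth_height n"
  shows "doubling S d"
  unfolding doubling_def
\<comment> \<open>There are 32 possible values for each of the two rounded coordinates, and
  \<open>n + 1\<close> bound the third component of the code.\<close>
proof (intro exI[of _ "32 * 32 * (n + 1)"] conjI ballI allI impI)
  fix s and r :: real assume s: "s \<in> S" and r: "0 < r"
  define F where "F = {x. x < r / 8 \<and> r / 8 \<le> H x}"
  have F: "card F \<le> n" "finite F"
    using card_long_close_teeth[of "r / 8" n] r by (auto simp: F_def H)
  \<comment> \<open>Points of the ball with the same code are less than \<open>r / 2\<close> apart; teeth based beyond \<open>r / 8\<close> are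
    separated by their base points, the long ones based before \<open>r / 8\<close> by the third component.\<close>
  define c where "c e = (\<lfloor>(X e - X s) * 16 / r\<rfloor>, \<lfloor>(Y e - Y s) * 16 / r\<rfloor>,
      if X e < r / 8 \<and> r / 8 \<le> Y e then Some (X e) else None)" for e
  define Q where "Q = {-16..15::int} \<times> {-16..15::int} \<times> insert None (Some ` F)"
  have "card (insert None (Some ` F)) = card F + 1"
    using F by (simp add: card_image)
  then have Q: "finite Q" "card Q \<le> 32 * 32 * (n + 1)"
    using F by (auto simp: Q_def card_cartesian_product)
  have cQ: "c e \<in> Q" if e: "e \<in> mball s r" for e
  proof -
    have XY: "\<bar>X e - X s\<bar> < r" "\<bar>Y e - Y s\<bar> < r"
      using e by (auto simp: d_def split: if_splits)
    have fl: "\<lfloor>z * 16 / r\<rfloor> \<in> {-16..15}" if "\<bar>z\<bar> < r" for z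
    proof -
      have "-16 \<le> z * 16 / r" "z * 16 / r < 16" using that r by (auto simp: field_simps)
      then show ?thesis by (simp add: le_floor_iff floor_le_iff)
    qed
    have "e \<in> S" using e by simp
    then have "X e \<in> F" if "X e < r / 8" "r / 8 \<le> Y e"
      using that by (simp add: F_def S_def)
    then show ?thesis
      unfolding c_def Q_def using fl[OF XY(1)] fl[OF XY(2)] by (simp only: mem_Sigma_iff) auto
  qed
  have cd: "d e e' < r / 2" if e: "e \<in> mball s r" "e' \<in> mball s r" and eq: "c e = c e'" for e e'
  proof -
    have fl: "\<bar>u - v\<bar> < r / 16" if "\<lfloor>(u - w) * 16 / r\<rfloor> = \<lfloor>(v - w) * 16 / r\<rfloor>" for u v w
    proof -
      have "\<bar>(u - w) * 16 / r - (v - w) * 16 / r\<bar> < 1" using that by linarith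
      then have "\<bar>(u - v) * 16 / r\<bar> < 1" by (simp add: left_diff_distrib diff_divide_distrib)
      then have "\<bar>(u - v) * 16\<bar> < r" using r by (simp add: abs_divide)
      then show ?thesis unfolding abs_mult by simp
    qed
    have X: "\<bar>X e - X e'\<bar> < r / 16" and Y: "\<bar>Y e - Y e'\<bar> < r / 16"
      using eq fl by (auto simp: c_def)
    have nn: "0 \<le> Y e" "0 \<le> Y e'" using e Y_nonneg by auto
    show ?thesis
    proof (cases "X e = X e' \<or> Y e < r / 8 \<or> Y e' < r / 8")
      case True
      moreover have "Y e < Y e' + r / 16" "Y e' < Y e + r / 16" using Y by linarith+
      moreover have "d e e' \<le> (if X e = X e' then \<bar>Y e - Y e'\<bar> else Y e + \<bar>X e - X e'\<bar> + Y e')"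
        using nn by (simp add: d_def)
      \<comment> \<open>On different teeth, one height is below \<open>r / 8\<close>, the other
        below \<open>3 * r / 16\<close>, and the base adds less than \<open>r / 16\<close>: in total
        less than \<open>3 * r / 8\<close>.\<close>
      ultimately show ?thesis using X Y nn r by (cases "X e = X e'"; simp; linarith)
    next
      case False
      then have ne: "X e \<noteq> X e'" and y: "r / 8 \<le> Y e" "r / 8 \<le> Y e'" by auto
      \<comment> \<open>A base point before \<open>r / 8\<close> would be recorded in the code, and
        equal codes would put both points on one tooth.\<close>
      have x: "r / 8 \<le> X e" "r / 8 \<le> X e'"
        using eq ne y by (auto simp: c_def split: if_splits)
      have "e \<in> S" "e' \<in> S" using e by auto
      then have "Y e \<le> H (X e)" "Y e' \<le> H (X e')" by (auto simp: S_def)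
      then have "0 < H (X e)" "0 < H (X e')" using y r by linarith+
      then obtain i j where ij: "X e = tooth i" "X e' = tooth j"
        by (auto simp: H tooth_height_def split: if_splits)
      have "i < j \<or> j < i" using ne ij by (metis linorder_neqE_nat)
      \<comment> \<open>Positions at least \<open>r / 8\<close> that differ by a factor of 2 are at
        least \<open>r / 8\<close> apart, against the bound \<open>r / 16\<close>.\<close>
      then have "tooth j \<le> tooth i / 2 \<or> tooth i \<le> tooth j / 2" using tooth_gap by blast
      then show ?thesis using X x ij by linarith
    qed
  qed
  define rep where "rep z = (SOME e. e \<in> mball s r \<and> c e = z)" for z
  have rep: "rep (c e) \<in> mball s r \<and> c (rep (c e)) = c e" if "e \<in> mball s r" for e
    unfolding rep_def using that by (rule_tac someI[of _ e]) blast
  let ?C = "rep ` c ` mball s r"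
  have "c ` mball s r \<subseteq> Q" using cQ by blast
  then have fin: "finite (c ` mball s r)" and le: "card (c ` mball s r) \<le> 32 * 32 * (n + 1)"
    using Q finite_subset card_mono order_trans by (blast, metis)
  show "\<exists>C. finite C \<and> C \<subseteq> S \<and> card C \<le> 32 * 32 * (n + 1) \<and> mball s r \<subseteq> (\<Union>c\<in>C. mball c (r / 2))"
  proof (intro exI[of _ ?C] conjI)
    show "finite ?C" using fin by blast
    show "?C \<subseteq> S" using rep by fastforce
    show "card ?C \<le> 32 * 32 * (n + 1)" using card_image_le[OF fin, of rep] le by linarith
    show "mball s r \<subseteq> (\<Union>c\<in>?C. mball c (r / 2))"
    proof
      fix e assume e: "e \<in> mball s r"
      then have "d (rep (c e)) e < r / 2" using cd[of "rep (c e)" e] rep[OF e] by blast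
      then show "e \<in> (\<Union>c\<in>?C. mball c (r / 2))" using e rep[OF e] by fastforce
    qed
  qed
qed simp

section \<open>Embedding combs\<close>

context Metric_space
begin

lemma doubling_iterate:
  assumes N: "\<And>x r. x \<in> M \<Longrightarrow> r > 0 \<Longrightarrow> \<exists>C. finite C \<and> C \<subseteq> M \<and> card C \<le> N \<and> mball x r \<subseteq> (\<Union>c\<in>C. mball c (r / 2))"
    and "x \<in> M" "r > 0"
  shows "\<exists>C. finite C \<and> C \<subseteq> M \<and> card C \<le> N ^ m \<and> mball x r \<subseteq> (\<Union>c\<in>C. mball c (r / 2 ^ m))"
proof (induction m)
  case 0
  show ?case using assms by (intro exI[of _ "{x}"]) auto
next
  case (Suc m)
  then obtain C where C: "finite C" "C \<subseteq> M" "card C \<le> N ^ m" "mball x r \<subseteq> (\<Union>c\<in>C. mball c (r / 2 ^ m))"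
    by blast
  have "\<exists>D. finite D \<and> D \<subseteq> M \<and> card D \<le> N \<and> mball c (r / 2 ^ m) \<subseteq> (\<Union>c\<in>D. mball c (r / 2 ^ Suc m))" if "c \<in> C" for c
    using N[of c "r / 2 ^ m"] that C \<open>r > 0\<close> by (auto simp: field_simps)
  then obtain D where D: "\<And>c. c \<in> C \<Longrightarrow> finite (D c) \<and> D c \<subseteq> M \<and> card (D c) \<le> N \<and>
        mball c (r / 2 ^ m) \<subseteq> (\<Union>c\<in>D c. mball c (r / 2 ^ Suc m))"
    by metis
  have "card (\<Union>(D ` C)) \<le> (\<Sum>c\<in>C. card (D c))" by (rule card_UN_le[OF C(1)])
  also have "\<dots> \<le> card C * N" using sum_bounded_above[of C "\<lambda>c. card (D c)" N] D by simp
  also have "\<dots> \<le> N ^ Suc m" using C(3) by simp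
  finally have card: "card (\<Union>(D ` C)) \<le> N ^ Suc m" .
  show ?case
  proof (intro exI[of _ "\<Union>(D ` C)"] conjI card)
    show "finite (\<Union>(D ` C))" "\<Union>(D ` C) \<subseteq> M" using C(1) D by blast+
    show "mball x r \<subseteq> (\<Union>c\<in>\<Union>(D ` C). mball c (r / 2 ^ Suc m))"
    proof
      fix u assume "u \<in> mball x r"
      then obtain c where "c \<in> C" "u \<in> mball c (r / 2 ^ m)" using C(4) by blast
      then obtain e where "e \<in> D c" "u \<in> mball e (r / 2 ^ Suc m)"
        using D[OF \<open>c \<in> C\<close>] by blast
      then show "u \<in> (\<Union>c\<in>\<Union>(D ` C). mball c (r / 2 ^ Suc m))" using \<open>c \<in> C\<close> by blast
    qed
  qed
qed

text \<open>After \<open>m\<close> halvings, each covering ball contains at most one point of the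
  separated set.\<close>

lemma card_separated_le:
  assumes N: "\<And>x r. x \<in> M \<Longrightarrow> r > 0 \<Longrightarrow> \<exists>C. finite C \<and> C \<subseteq> M \<and> card C \<le> N \<and> mball x r \<subseteq> (\<Union>c\<in>C. mball c (r / 2))"
    and "x \<in> M" "r > 0" "F \<subseteq> mball x r"
    and sep: "\<And>u v. u \<in> F \<Longrightarrow> v \<in> F \<Longrightarrow> u \<noteq> v \<Longrightarrow> 2 * r / 2 ^ m \<le> d u v"
  shows "card F \<le> N ^ m"
proof -
  obtain C where C: "finite C" "card C \<le> N ^ m" "mball x r \<subseteq> (\<Union>c\<in>C. mball c (r / 2 ^ m))"
    using doubling_iterate[OF N assms(2,3)] by blast
  then have "\<exists>c\<in>C. u \<in> mball c (r / 2 ^ m)" if "u \<in> F" for u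
    using that assms(4) by blast
  then obtain k where k: "\<And>u. u \<in> F \<Longrightarrow> k u \<in> C \<and> u \<in> mball (k u) (r / 2 ^ m)" by metis
  have "inj_on k F"
  proof (rule inj_onI, rule ccontr)
    fix u v assume uv: "u \<in> F" "v \<in> F" "k u = k v" "u \<noteq> v"
    then have "d u v < r / 2 ^ m + r / 2 ^ m"
      using k[of u] k[of v] triangle[of u "k u" v] commute[of u] by auto
    then show False using sep[OF uv(1,2,4)] by simp
  qed
  then have "card F \<le> card C" using C(1) k by (intro card_inj_on_le) auto
  then show ?thesis using C(2) by linarith
qed

end

text \<open>Removing 0 leaves the half-line connected, whereas removing a positive point does not;
  so \<open>eta\<close> fixes 0, and continuity does the rest.\<close>

lemma half_line_homeomorphism_at_0:
  assumes "homeomorphic_map (top_of_set {0::real..}) (top_of_set {0::real..}) eta" "e > 0"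
  shows "\<exists>\<delta>>0. \<forall>t. 0 \<le> t \<and> t \<le> \<delta> \<longrightarrow> eta t < e"
proof -
  have cont: "continuous_on {0..} eta" and im: "eta ` {0..} = {0..}" and inj: "inj_on eta {0..}"
    using homeomorphic_imp_continuous_map[OF assms(1)] homeomorphic_imp_surjective_map[OF assms(1)]
      homeomorphic_imp_injective_map[OF assms(1)] by auto
  have "eta 0 = 0"
  proof (rule ccontr)
    assume "eta 0 \<noteq> 0"
    then have pos: "eta 0 > 0" using im by (metis atLeast_iff image_eqI less_eq_real_def)
    have "connected (eta ` {0<..})"
      using cont by (intro connected_continuous_image continuous_on_subset[OF cont]) auto
    moreover have im': "eta ` {0<..} = {0..} - {eta 0}"
    proof -
      have "{0<..} = {0..} - {0::real}" by auto
      then show ?thesis using inj_on_image_set_diff[OF inj, of "{0..}" "{0}"] im by simp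
    qed
    ultimately have "{0..eta 0 + 1} \<subseteq> eta ` {0<..}"
      using pos by (intro connected_contains_Icc) auto
    moreover have "eta 0 \<in> {0..eta 0 + 1}" using pos by simp
    ultimately show False unfolding im' by blast
  qed
  moreover obtain \<delta> where "\<delta> > 0" "\<And>t. t \<ge> 0 \<Longrightarrow> dist t 0 < \<delta> \<Longrightarrow> dist (eta t) (eta 0) < e"
    using cont assms(2) unfolding continuous_on_iff by (metis atLeast_iff order_refl)
  ultimately show ?thesis
    by (intro exI[of _ "\<delta> / 2"]) (auto simp: dist_real_def abs_less_iff)
qed

text \<open>This moves the planar comb to a set of reals.\<close>

lemma exists_real_pairing: "\<exists>b :: real \<times> real \<Rightarrow> real. bij b"
  using card_of_Times_same_infinite[OF infinite_UNIV_char_0[where 'a = real]]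
  unfolding card_of_ordIso[symmetric] by simp

text \<open>The trees to be embedded are carried by sets of reals. Failure of universality for these
  already implies its failure for all trees.\<close>

theorem theorem1p1:
  fixes T :: "'a set" and dT :: "'a \<Rightarrow> 'a \<Rightarrow> real"
  shows "\<not> (quasiconformal_tree T dT \<and>
            (\<forall>(S :: real set) (dS :: real \<Rightarrow> real \<Rightarrow> real).
               quasiconformal_tree S dS \<and> valence S dS \<le> 3 \<longrightarrow>
               (\<exists>f. qs_embedding S dS T dT f)))"
proof (intro notI, elim conjE)
  assume T: "quasiconformal_tree T dT" and
    univ: "\<forall>(S :: real set) (dS :: real \<Rightarrow> real \<Rightarrow> real). quasiconformal_tree S dS \<and> valence S dS \<le> 3 \<longrightarrow>
               (\<exists>f. qs_embedding S dS T dT f)"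
  interpret T: Metric_space T dT using T by (simp add: quasiconformal_tree_def metric_tree_def)
  obtain N where N: "\<And>x r. x \<in> T \<Longrightarrow> r > 0 \<Longrightarrow>
      \<exists>C. finite C \<and> C \<subseteq> T \<and> card C \<le> N \<and> T.mball x r \<subseteq> (\<Union>c\<in>C. T.mball c (r / 2))"
    using T unfolding quasiconformal_tree_def doubling_def by metis
  obtain c where c: "c \<ge> 1" and arcs: "\<And>x y A u. is_arc_between T dT A x y \<Longrightarrow> x \<noteq> y \<Longrightarrow> u \<in> A \<Longrightarrow> dT x u \<le> c * dT x y"
    using bounded_turning_arcs[of T dT] T unfolding quasiconformal_tree_def by metis
  \<comment> \<open>The image points will be \<open>3 * R / (4 * c)\<close> apart in a ball of
    radius \<open>2 * R\<close>. The separation bound then needs \<open>2 ^ m\<close> to be at least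
    \<open>16 * c / 3\<close>, which \<open>6 * c\<close> exceeds.\<close>
  obtain m where m: "6 * c < 2 ^ m" using real_arch_pow[of 2 "6 * c"] by auto
  define n where "n = N ^ m + 1"
  obtain b :: "real \<times> real \<Rightarrow> real" where b: "bij b" using exists_real_pairing by blast
  interpret comb "\<lambda>x y. b (x, y)" "\<lambda>s. fst (inv b s)" "\<lambda>s. snd (inv b s)" "tooth_height n"
    using b tooth_height_nonneg finite_tooth_height
    by unfold_locales (auto simp: bij_is_inj bij_is_surj surj_f_inv_f)
  let ?P = "\<lambda>x y. b (x, y)" and ?X = "\<lambda>s. fst (inv b s)" and ?Y = "\<lambda>s. snd (inv b s)"
  obtain f where "qs_embedding S d T dT f"
    using univ metric_tree_S doubling_S[OF refl] bounded_turning_S valence_S unfolding quasiconformal_tree_def by blast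
  then obtain eta where fT: "f ` S \<subseteq> T" and hom: "homeomorphic_map mtopology (subtopology T.mtopology (f ` S)) f"
    and eta: "homeomorphic_map (top_of_set {0::real..}) (top_of_set {0::real..}) eta"
    and qs: "\<And>x a b. x \<in> S \<Longrightarrow> a \<in> S \<Longrightarrow> b \<in> S \<Longrightarrow> x \<noteq> b \<Longrightarrow> dT (f x) (f a) / dT (f x) (f b) \<le> eta (d x a / d x b)"
    unfolding qs_embedding_def by blast
  have inj: "inj_on f S" using homeomorphic_imp_injective_map[OF hom] by simp
  have contf: "continuous_map mtopology T.mtopology f"
    using homeomorphic_imp_continuous_map[OF hom] by (simp add: continuous_map_in_subtopology)
  obtain \<delta> where \<delta>: "\<delta> > 0" "\<And>t. 0 \<le> t \<Longrightarrow> t \<le> \<delta> \<Longrightarrow> eta t < 1 / 4"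
    using half_line_homeomorphism_at_0[OF eta, of "1 / 4"] by auto
  \<comment> \<open>The ratio \<open>tooth (Suc j) / tooth j\<close> is \<open>1 / (j + 2)\<close>,
    hence at most \<open>\<delta>\<close>.\<close>
  obtain j :: nat where j: "1 / \<delta> < j" using reals_Archimedean2 by blast
  have ratio: "tooth (Suc j) \<le> \<delta> * tooth j"
  proof -
    have "1 \<le> \<delta> * (real j + 2)" using j \<delta>(1) by (simp add: field_simps)
    then have "tooth j \<le> (\<delta> * tooth j) * (real j + 2)"
      using tooth_pos[of j] by (simp add: mult.assoc mult.commute mult.left_commute mult_le_cancel_left1)
    then show ?thesis unfolding tooth_Suc by (simp add: pos_divide_le_eq)
  qed
  \<comment> \<open>For these \<open>n\<close> indices \<open>i - n \<le> j\<close>, so the teeth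
    have length at least \<open>tooth j\<close>, while their feet lie within
    \<open>tooth (Suc j)\<close> of \<open>p\<close>.\<close>
  define I where "I = {Suc j..j + n}"
  have I: "finite I" "I \<noteq> {}" "card I = n" by (auto simp: I_def n_def)
  define p where "p = ?P 0 0"
  define q where "q i = ?P (tooth i) 0" for i
  define a where "a i = ?P (tooth i) (tooth j)" for i
  have p: "p \<in> S" using base_in_S[of 0] by (simp add: p_def)
  have q: "q i \<in> S" for i using base_in_S[of "tooth i"] tooth_pos[of i] tooth_le_1[of i] by (simp add: q_def)
  have a: "a i \<in> S" if "i \<in> I" for i
  proof -
    have "tooth j \<le> tooth (i - n)" using that by (intro tooth_antimono) (auto simp: I_def)
    then show ?thesis using tooth_pos[of i] tooth_pos[of j] tooth_le_1[of i] X_P Y_P by (simp add: S_def a_def)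
  qed
  have dpq: "d p (q i) = tooth i" and dpa: "d p (a i) = tooth i + tooth j" for i
    using tooth_pos[of i] tooth_pos[of j] X_P Y_P by (simp_all add: d_def p_def q_def a_def)
  have pa: "p \<noteq> a i" if "i \<in> I" for i
    using dpa[of i] tooth_pos[of i] tooth_pos[of j] p by auto
  \<comment> \<open>The minimum puts every image of \<open>a i\<close> at distance at least
    \<open>R\<close> from the image of \<open>p\<close>. Since the feet go within
    \<open>R / 4\<close>, each tooth image meets the sphere of radius \<open>R\<close>.\<close>
  define R where "R = Min ((\<lambda>i. dT (f p) (f (a i))) ` I)"
  have Rle: "R \<le> dT (f p) (f (a i))" if "i \<in> I" for i
    unfolding R_def using I that by (intro Min_le) auto
  obtain i0 where i0: "i0 \<in> I" "R = dT (f p) (f (a i0))"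
    using Min_in[of "(\<lambda>i. dT (f p) (f (a i))) ` I"] I unfolding R_def by blast
  have R: "R > 0"
    unfolding i0(2)
  proof (rule T.mdist_pos_less)
    show "f p \<noteq> f (a i0)" using inj_onD[OF inj _ p a[OF i0(1)]] pa[OF i0(1)] by blast
  qed (use fT p a[OF i0(1)] in blast)+
  have core: "dT (f p) (f (q k)) \<le> R / 4" if k: "k \<in> I" for k
  proof -
    have "tooth k \<le> tooth (Suc j)" using k by (intro tooth_antimono) (auto simp: I_def)
    then have "tooth k \<le> \<delta> * tooth j" using ratio by linarith
    also have "\<dots> \<le> \<delta> * (tooth i0 + tooth j)" using \<delta>(1) tooth_pos[of i0] by simp
    finally have "d p (q k) / d p (a i0) \<le> \<delta>"
      unfolding dpq dpa using tooth_pos[of i0] tooth_pos[of j] by (simp add: pos_divide_le_eq)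
    moreover have "0 \<le> d p (q k) / d p (a i0)" by simp
    ultimately have "dT (f p) (f (q k)) / dT (f p) (f (a i0)) < 1 / 4"
      using qs[OF p q a[OF i0(1)] pa[OF i0(1)], of k] \<delta>(2) by (meson le_less_trans)
    then show ?thesis using R unfolding i0(2)[symmetric] by (simp add: field_simps)
  qed
  have "\<exists>v. v \<in> S \<and> ?X v = tooth i \<and> dT (f p) (f v) = R" if i: "i \<in> I" for i
  proof -
    have "continuous_map T.mtopology euclideanreal (dT (f p))"
    proof (rule T.continuous_map_Lipschitz_real[where B = 1])
      show "\<bar>dT (f p) s - dT (f p) t\<bar> \<le> 1 * dT s t" if "s \<in> T" "t \<in> T" for s t
        using T.mdist_reverse_triangle[of s "f p" t] that p fT T.commute[of "f p"] by auto
    qed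
    then have cont: "continuous_map mtopology euclideanreal (\<lambda>v. dT (f p) (f v))"
      using continuous_map_compose[OF contf] by (simp add: o_def)
    obtain v where v: "v \<in> seg (q i) (a i)" "dT (f p) (f v) = R"
      using connectedin_IVT[OF cont connectedin_seg[OF q[of i] a[OF i]], of "q i" "a i" R]
        ends_in_seg[OF q[of i] a[OF i]] core[OF i] Rle[OF i] R by auto
    moreover have "v \<in> S" using v seg_subset[OF q[of i] a[OF i]] by blast
    moreover have "?X v = tooth i"
      using seg_cases[OF q[of i] a[OF i] v(1)] X_P by (auto simp: q_def a_def)
    ultimately show ?thesis by blast
  qed
  then obtain v where v: "\<And>i. i \<in> I \<Longrightarrow> v i \<in> S \<and> ?X (v i) = tooth i \<and> dT (f p) (f (v i)) = R"
    by metis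
  define F where "F = (f \<circ> v) ` I"
  have neq: "v i \<noteq> v k" if "i \<in> I" "k \<in> I" "i \<noteq> k" for i k
    using v[OF that(1)] v[OF that(2)] inj_tooth that(3) by (metis injD)
  then have "inj_on (f \<circ> v) I"
    using v inj by (intro inj_onI) (metis comp_apply inj_onD)
  then have cardF: "card F = n" using I(3) unfolding F_def by (simp only: card_image)
  \<comment> \<open>The image of the segment is the arc from \<open>f (v i)\<close> to
    \<open>f (v k)\<close>. It passes through \<open>f (q i)\<close>, which is at least
    \<open>R - R / 4\<close> away from \<open>f (v i)\<close>, and the arc bound applies.\<close>
  have sep: "3 * R / 4 \<le> c * dT (f (v i)) (f (v k))" if ik: "i \<in> I" "k \<in> I" "i \<noteq> k" for i k
  proof -
    have S: "v i \<in> S" "v k \<in> S" using v ik by auto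
    have "?X (v i) \<noteq> ?X (v k)" using v ik inj_tooth by (metis injD)
    then have foot: "q i \<in> seg (v i) (v k)"
      using foot_in_seg[OF S] v[OF ik(1)] by (simp add: q_def)
    define g where "g \<theta> = geo (v i) (v k) (\<theta> * d (v i) (v k))" for \<theta>
    note path = seg_path[OF S, folded g_def]
    have "inj_on (f \<circ> g) {0..1}"
      using comp_inj_on[OF path(5)[OF neq[OF ik]]] path(2) inj_on_subset[OF inj seg_subset[OF S]] by simp
    then have "is_arc_between T dT ((f \<circ> g) ` {0..1}) ((f \<circ> g) 0) ((f \<circ> g) 1)"
      by (rule is_arc_between_image[OF T.Metric_space_axioms continuous_map_compose[OF path(1) contf]])
    then have "is_arc_between T dT (f ` seg (v i) (v k)) (f (v i)) (f (v k))"
      unfolding image_comp[symmetric] path(2) by (simp only: comp_apply path(3,4))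
    moreover have "f (v i) \<noteq> f (v k)" using S inj neq[OF ik] by (metis inj_onD)
    ultimately have "dT (f (v i)) (f (q i)) \<le> c * dT (f (v i)) (f (v k))"
      using arcs foot by blast
    moreover have "R \<le> R / 4 + dT (f (v i)) (f (q i))"
      using T.triangle'[of "f p" "f (q i)" "f (v i)"] v[OF ik(1)] core[OF ik(1)] p q fT by (auto simp: image_subset_iff)
    ultimately show ?thesis by linarith
  qed
  have "card F \<le> N ^ m"
  \<comment> \<open>The points lie at distance exactly \<open>R\<close>, so the open ball needs a
    larger radius.\<close>
  proof (rule T.card_separated_le[OF N, of "f p" "2 * R"])
    show "f p \<in> T" using p fT by blast
    show "F \<subseteq> T.mball (f p) (2 * R)"
      using v p fT R by (auto simp: F_def image_subset_iff)
    fix u w assume "u \<in> F" "w \<in> F" "u \<noteq> w"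
    then obtain i k where "i \<in> I" "k \<in> I" "i \<noteq> k" "u = f (v i)" "w = f (v k)"
      by (auto simp: F_def)
    then have s: "3 * R / 4 \<le> c * dT u w" using sep by simp
    have "2 * (2 * R) / 2 ^ m \<le> 2 * (2 * R) / (6 * c)"
      using m c R by (intro divide_left_mono) auto
    also have "\<dots> \<le> 3 * R / 4 / c" using c R by (simp add: field_simps)
    also have "\<dots> \<le> dT u w" using s c by (simp add: field_simps)
    finally show "2 * (2 * R) / 2 ^ m \<le> dT u w" .
  qed (use R in auto)
  then show False using cardF by (simp add: n_def)
qed

end
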